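(* (i) For every even integer $\ell\geq 4$ and every integer $r\geq 2$, setting $$\varepsilon:=\frac{r-1}{\max\{R(C_\ell,r),\,2r+1\}},$$ we have $\varepsilon<1/2$ and $$r-\varepsilon \;\leq\; m^*(C_\ell,r) \;<\; r+1 .$$ (ii) There is a function $f$ (depending on $r$ only) such that for every odd integer $\ell\geq 3$ and every integer $r\geq 2$ we have $$2^{r-1}\;\leq\; m^*(C_\ell,r)\;\leq\; f(r).$$
   Context: All graphs are finite and simple. For a graph $F$ and an integer $r\geq 2$, a graph $G$ is called $(F,r)$-Ramsey if every $r$-coloring of the edges of $G$ contains a monochromatic copy of $F$ (as a not necessarily induced subgraph). For a graph $G$ define $m(G):=\max_{H\subseteq G} e(H)/v(H)$, where the maximum is over all subgraphs $H$ of $G$ with at least one vertex, and $e(H)$, $v(H)$ are the numbers of edges and vertices of $H$. The Ramsey density is $m^*(F,r):=\inf\{m(G) : G \text{ is } (F,r)\text{-Ramsey}\}$. The Ramsey number $R(F,r)$ is the minimal integer $N$ such that the complete graph $K_N$ is $(F,r)$-Ramsey. $C_\ell$ denotes the cycle of length $\ell$. *)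

theory Defs
  imports Complex_Main "HOL-Library.Ramsey"
begin

record 'a graph =
  verts :: "'a set"
  edges :: "'a set set"

definition simple_graph :: "'a graph \<Rightarrow> bool" where
  "simple_graph G \<longleftrightarrow> finite (verts G) \<and> edges G \<subseteq> [verts G]\<^bsup>2\<^esup>"

definition subgraph :: "'a graph \<Rightarrow> 'a graph \<Rightarrow> bool" where
  "subgraph H G \<longleftrightarrow> simple_graph H \<and> verts H \<subseteq> verts G \<and> edges H \<subseteq> edges G"

definition contains_copy :: "'b graph \<Rightarrow> 'a graph \<Rightarrow> bool" where
  "contains_copy G F \<longleftrightarrow>
     (\<exists>\<phi>. inj_on \<phi> (verts F) \<and> \<phi> ` verts F \<subseteq> verts G \<and> (\<forall>e\<in>edges F. \<phi> ` e \<in> edges G))"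

definition colour_class :: "'b graph \<Rightarrow> ('b set \<Rightarrow> nat) \<Rightarrow> nat \<Rightarrow> 'b graph" where
  "colour_class G c i = \<lparr>verts = verts G, edges = {e \<in> edges G. c e = i}\<rparr>"

definition is_Ramsey :: "'a graph \<Rightarrow> nat \<Rightarrow> 'b graph \<Rightarrow> bool" where
  "is_Ramsey F r G \<longleftrightarrow>
     (\<forall>c \<in> edges G \<rightarrow> {..<r}. \<exists>i<r. contains_copy (colour_class G c i) F)"

definition max_density :: "'a graph \<Rightarrow> real" where
  "max_density G =
     Max {real (card (edges H)) / real (card (verts H)) |H. subgraph H G \<and> verts H \<noteq> {}}"

text \<open>
  Every finite graph is isomorphic to one on natural numbers, so letting \<open>G\<close> range over
  graphs with vertices in \<^typ>\<open>nat\<close> loses nothing.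
\<close>

definition Ramsey_density :: "'a graph \<Rightarrow> nat \<Rightarrow> real" where
  "Ramsey_density F r =
     Inf {max_density G |G :: nat graph. simple_graph G \<and> is_Ramsey F r G}"

definition complete_graph :: "nat \<Rightarrow> nat graph" where
  "complete_graph N = \<lparr>verts = {..<N}, edges = [{..<N}]\<^bsup>2\<^esup>\<rparr>"

definition Ramsey_number :: "'a graph \<Rightarrow> nat \<Rightarrow> nat" where
  "Ramsey_number F r = (LEAST N. is_Ramsey F r (complete_graph N))"

text \<open>A cycle only for \<open>l \<ge> 3\<close>; smaller values of \<open>l\<close> are never used.\<close>

definition cycle_graph :: "nat \<Rightarrow> nat graph" where
  "cycle_graph l = \<lparr>verts = {..<l}, edges = {{i, Suc i mod l} |i. i < l}\<rparr>"

text \<open>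
  The set whose maximum defines \<^const>\<open>max_density\<close> is finite and nonempty, the minimum in
  \<^const>\<open>Ramsey_number\<close> exists, and the set whose infimum defines \<^const>\<open>Ramsey_density\<close>
  is nonempty and bounded below; so none of these takes an unspecified value.
\<close>

lemma max_density_set:
  assumes "simple_graph G" and "verts G \<noteq> {}"
  defines "S \<equiv> {real (card (edges H)) / real (card (verts H)) |H. subgraph H G \<and> verts H \<noteq> {}}"
  shows "finite S" and "S \<noteq> {}"
proof -
  have fin: "finite (verts G)" "finite (edges G)"
    using assms(1) finite_subset[OF _ finite_imp_finite_nsets] by (auto simp: simple_graph_def)
  have "S \<subseteq> (\<lambda>(V, E). real (card E) / real (card V)) ` (Pow (verts G) \<times> Pow (edges G))"
    by (auto simp: S_def subgraph_def)
  then show "finite S"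
    by (rule finite_subset) (use fin in auto)
  have "subgraph G G"
    using assms(1) by (simp add: subgraph_def)
  then show "S \<noteq> {}"
    using assms(2) by (auto simp: S_def)
qed

lemma simple_complete_graph: "simple_graph (complete_graph N)"
  by (simp add: simple_graph_def complete_graph_def)

lemma simple_cycle_graph:
  assumes "l \<ge> 3"
  shows "simple_graph (cycle_graph l)"
proof -
  have "{i, Suc i mod l} \<in> [{..<l}]\<^bsup>2\<^esup>" if "i < l" for i
    using assms that by (cases "Suc i = l") auto
  then show ?thesis
    by (auto simp: simple_graph_def cycle_graph_def)
qed

lemma complete_graph_is_Ramsey:
  assumes F: "simple_graph F"
  shows "\<exists>N. is_Ramsey F r (complete_graph N)"
proof -
  let ?n = "card (verts F)"
  obtain N where N: "partn_lst {..<N::nat} (replicate r ?n) 2"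
    using ramsey_full by blast
  have "is_Ramsey F r (complete_graph N)"
    unfolding is_Ramsey_def
  proof
    fix c assume "c \<in> edges (complete_graph N) \<rightarrow> {..<r}"
    then have "c \<in> [{..<N}]\<^bsup>2\<^esup> \<rightarrow> {..<length (replicate r ?n)}"
      by (simp add: complete_graph_def)
    then obtain i H where i: "i < r" and H: "H \<in> [{..<N}]\<^bsup>?n\<^esup>" and mono: "c ` [H]\<^bsup>2\<^esup> \<subseteq> {i}"
      using N by (fastforce simp: partn_lst_def monochromatic_def)
    have "finite (verts F)" "finite H" "card H = ?n" "H \<subseteq> {..<N}"
      using F H by (auto simp: simple_graph_def nsets_def)
    then obtain \<phi> where \<phi>: "bij_betw \<phi> (verts F) H"
      using finite_same_card_bij by metis
    have "\<phi> ` e \<in> edges (colour_class (complete_graph N) c i)" if "e \<in> edges F" for e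
    proof -
      have "e \<in> [verts F]\<^bsup>2\<^esup>"
        using F that by (auto simp: simple_graph_def)
      then have "\<phi> ` e \<in> [H]\<^bsup>2\<^esup>"
        using bij_betw_nsets[OF \<phi>, of 2] by (auto simp: bij_betw_def)
      then show ?thesis
        using mono nsets_mono[OF \<open>H \<subseteq> {..<N}\<close>, of 2]
        by (auto simp: colour_class_def complete_graph_def)
    qed
    then have "contains_copy (colour_class (complete_graph N) c i) F"
      using \<phi> \<open>H \<subseteq> {..<N}\<close>
      by (auto simp: contains_copy_def bij_betw_def colour_class_def complete_graph_def intro!: exI[of _ \<phi>])
    then show "\<exists>i<r. contains_copy (colour_class (complete_graph N) c i) F"
      using i by blast
  qed
  then show ?thesis ..
qed

lemma Ramsey_density_set:
  fixes F :: "'a graph" and r :: nat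
  assumes F: "simple_graph F" "verts F \<noteq> {}"
  defines "S \<equiv> {max_density G |G :: nat graph. simple_graph G \<and> is_Ramsey F r G}"
  shows "S \<noteq> {}" and "bdd_below S"
proof -
  show "S \<noteq> {}"
    using complete_graph_is_Ramsey[OF F(1)] simple_complete_graph by (auto simp: S_def)
  have "max_density G \<ge> 0" if G: "simple_graph G" "is_Ramsey F r G" for G :: "nat graph"
  proof -
    have "verts G \<noteq> {}"
    proof
      assume "verts G = {}"
      then have "edges G = {}"
        using G(1) by (auto simp: simple_graph_def nsets_empty_iff)
      then show False
        using G(2) F(2) \<open>verts G = {}\<close>
        by (auto simp: is_Ramsey_def contains_copy_def colour_class_def)
    qed
    note S = max_density_set[OF G(1) this]
    have "max_density G \<in> {real (card (edges H)) / real (card (verts H)) |H. subgraph H G \<and> verts H \<noteq> {}}"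
      unfolding max_density_def by (rule Max_in[OF S])
    then show ?thesis by auto
  qed
  then show "bdd_below S"
    by (auto simp: S_def intro!: bdd_belowI[of _ 0])
qed

end

theory Submission
  imports Defs "HOL-Library.Disjoint_Sets" "HOL-Library.Nat_Bijection"
begin

text \<open>
  \<^bold>\<open>Lower bound with \<epsilon>.\<close> A colour class without cycles contains no
  \<open>C\<^sub>l\<close>, and by Nash-Williams a graph is a union of \<open>r\<close> forests as
  soon as \<open>e(W) \<le> r(|W| - 1)\<close> for every nonempty vertex set \<open>W\<close>. If
  \<open>m(G) < r - \<epsilon>\<close> then only vertex sets with fewer than \<open>R(C\<^sub>l,
  r)\<close> vertices can violate this: a set of at most \<open>2r\<close> vertices does not have
  enough pairs of vertices, and for a larger set \<open>\<epsilon>\<close> is chosen such that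
  \<open>(r - \<epsilon>)|W|\<close> drops to \<open>r|W| - (r - 1)\<close> once \<open>|W| \<ge>
  max(R, 2r + 1)\<close>. A set with fewer than \<open>R(C\<^sub>l, r)\<close> vertices can be
  coloured without a monochromatic \<open>C\<^sub>l\<close> by the definition of
  \<open>R(C\<^sub>l, r)\<close>. To combine the two colourings, violating sets are contracted
  until the multigraph on the blocks satisfies Nash-Williams' condition; a monochromatic cycle
  that leaves a block would give a cycle in one of the forests of this multigraph, and one that
  stays in a block is excluded by the colouring of that block (\<open>sparse_not_Ramsey\<close>).
  Nash-Williams' theorem is derived from Edmonds' partition theorem for matroids, whose
  augmentation argument (\<open>augment_colouring\<close>) needs only a closure operator with the
  exchange property.

  \<^bold>\<open>Lower bound for odd cycles.\<close> If \<open>m(G) < 2 ^ (r - 1)\<close> then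
  every subgraph has a vertex of degree below \<open>2 ^ r\<close>, so \<open>G\<close> is
  properly \<open>2 ^ r\<close>-colourable. Colouring each edge by a binary digit in which the
  colours of its ends differ makes all \<open>r\<close> colour classes bipartite.

  \<^bold>\<open>Upper bounds.\<close> Consider an infinite graph on the natural numbers in which
  each vertex is joined to at most \<open>D\<close> smaller ones, and every set of at most
  \<open>D\<close> vertices is exactly the set of smaller neighbours of infinitely many vertices.
  All its finite subgraphs have density below \<open>D\<close>, and by compactness one of them is
  Ramsey as soon as every \<open>r\<close>-colouring of the infinite graph has a monochromatic
  \<open>C\<^sub>l\<close>. A vertex set \<open>W\<close> is called \<open>d\<close>-rich if any
  at most \<open>d\<close> of its members have infinitely many common larger neighbours in
  \<open>W\<close>. Richness survives partitions: if \<open>W\<close> is \<open>qd\<close>-rich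
  and is cut into \<open>q\<close> parts, some part is \<open>d\<close>-rich, for otherwise the
  union of the bad sets of all parts would be a bad set for \<open>W\<close>. Among \<open>r +
  1\<close> vertices every common neighbour sees two in the same colour. Hence, if
  \<open>W\<close> is rich enough, any \<open>r + 1\<close> of its vertices include two that are
  joined in one colour to all vertices of a common \<open>d\<close>-rich set, and Ramsey's theorem
  gives an infinite set \<open>A\<close> and one colour \<open>j\<close> such that all pairs in
  \<open>A\<close> have this property (\<open>rich_common_neighbours\<close>).

  For \<open>d = 0\<close> the value \<open>D = r + 1\<close> suffices. The pairs in
  \<open>A\<close> have infinitely many common neighbours in colour \<open>j\<close>, so that
  paths with two edges chain up to all even cycles. For odd cycles, take two vertices of
  \<open>A\<close> and their rich set \<open>U\<close>. An edge of colour \<open>j\<close> inside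
  \<open>U\<close> gives a path with three edges between the two vertices, which closes to every
  odd cycle of length at least 5. If there is no such edge then one colour fewer occurs inside the
  rich set \<open>U\<close>, and induction on the number of colours finishes the proof, because a
  \<open>1\<close>-rich set contains an edge. The required \<open>D\<close> depends on
  \<open>r\<close> only.
\<close>

section \<open>Partitioning a finite set into independent sets of a matroid\<close>

text \<open>
  The closure operator of a matroid on a possibly infinite ground set.
\<close>

locale exchange_closure =
  fixes cl :: "'e set \<Rightarrow> 'e set"
  assumes cl_extensive: "A \<subseteq> cl A"
    and cl_mono: "A \<subseteq> B \<Longrightarrow> cl A \<subseteq> cl B"
    and cl_idem: "cl (cl A) = cl A"
    and cl_exchange: "y \<in> cl (insert x A) \<Longrightarrow> y \<notin> cl A \<Longrightarrow> x \<in> cl (insert y A)"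
begin

definition indep :: "'e set \<Rightarrow> bool" where
  "indep A \<longleftrightarrow> (\<forall>x\<in>A. x \<notin> cl (A - {x}))"

lemma cl_least: "A \<subseteq> cl B \<Longrightarrow> cl A \<subseteq> cl B"
  using cl_mono cl_idem by blast

lemma indep_subset: "indep B \<Longrightarrow> A \<subseteq> B \<Longrightarrow> indep A"
  unfolding indep_def by (meson Diff_mono cl_mono order_refl subsetD)

lemma indep_insert:
  assumes "indep A" "x \<notin> cl A"
  shows "indep (insert x A)"
  unfolding indep_def
proof
  fix y assume y: "y \<in> insert x A"
  show "y \<notin> cl (insert x A - {y})"
  proof (cases "y = x")
    case True
    then show ?thesis
      using assms(2) cl_mono[of "insert x A - {x}" A] by blast
  next
    case False
    then have eq: "insert x A - {y} = insert x (A - {y})" and "insert y (A - {y}) = A"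
      using y by auto
    moreover have "y \<notin> cl (A - {y})"
      using assms(1) y False by (auto simp: indep_def)
    ultimately show ?thesis
      using cl_exchange[of y x "A - {y}"] assms(2) by auto
  qed
qed

text \<open>
  \<open>C\<close> is chosen with as few elements as possible such that \<open>e \<in> cl
  C\<close>; this minimality allows every member of \<open>C\<close> to be exchanged for
  \<open>e\<close>. One of them lies outside \<open>D\<close> because \<open>e \<notin> cl
  D\<close>.
\<close>

lemma circuit_exchange:
  assumes "indep A" and "finite B" and "B \<subseteq> A" and "e \<in> cl B" and "e \<notin> cl D"
  obtains C x where "C \<subseteq> B" "x \<in> C" "x \<notin> D" "e \<in> cl C" "x \<in> cl (insert e (C - {x}))"
    "indep (insert e (A - {x}))"
proof -
  define C where "C = (ARG_MIN card C. C \<subseteq> B \<and> e \<in> cl C)"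
  have C: "C \<subseteq> B" "e \<in> cl C"
    and least: "\<And>C'. C' \<subseteq> B \<Longrightarrow> e \<in> cl C' \<Longrightarrow> card C \<le> card C'"
    unfolding C_def
    using arg_min_nat_lemma[of "\<lambda>C. C \<subseteq> B \<and> e \<in> cl C" B card] assms(4) by auto
  have "\<not> C \<subseteq> D"
    using C(2) assms(5) cl_mono by blast
  then obtain x where x: "x \<in> C" "x \<notin> D"
    by blast
  have "e \<notin> cl (C - {x})"
    using least[of "C - {x}"] C(1) x(1) card_Diff1_less[OF finite_subset[OF C(1) assms(2)] x(1)]
    by auto
  then have x_cl: "x \<in> cl (insert e (C - {x}))"
    using cl_exchange[of e x "C - {x}"] C(2) x(1) by (simp add: insert_absorb)
  have "e \<notin> cl (A - {x})"
  proof
    assume "e \<in> cl (A - {x})"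
    then have "insert e (C - {x}) \<subseteq> cl (A - {x})"
      using C(1) assms(3) cl_extensive[of "A - {x}"] by blast
    then have "x \<in> cl (A - {x})"
      using x_cl cl_least by blast
    then show False
      using assms(1,3) C(1) x(1) by (auto simp: indep_def)
  qed
  then have "indep (insert e (A - {x}))"
    using indep_insert indep_subset[OF assms(1)] by blast
  then show thesis
    using that C x x_cl by blast
qed

text \<open>
  A colouring \<open>c\<close> with a value in \<open>{..<r}\<close> colours an element, and the
  value \<open>r\<close> marks an uncoloured one. The levels shrink \<open>E\<close> by repeatedly
  passing to what one colour class spans inside the previous level; the list records the colours
  that were used, the latest one first. An element that drops out at some level is one for which
  room can be made by exchanges, and if no further shrinking is possible then every class spans
  the whole level.
\<close>

primrec level :: "'e set \<Rightarrow> ('e \<Rightarrow> nat) \<Rightarrow> nat list \<Rightarrow> 'e set" where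
  "level E c [] = E"
| "level E c (i # is) = level E c is \<inter> cl {x \<in> level E c is. c x = i}"

definition partial_colouring :: "'e set \<Rightarrow> nat \<Rightarrow> ('e \<Rightarrow> nat) \<Rightarrow> bool" where
  "partial_colouring E r c \<longleftrightarrow> (\<forall>x\<in>E. c x \<le> r) \<and> (\<forall>i<r. indep {x \<in> E. c x = i})"

lemma level_subset: "level E c is \<subseteq> E"
  by (induction "is") auto

text \<open>
  Exchanging \<open>x\<close> for \<open>e\<close> along a circuit inside a level changes neither
  the levels up to this one nor the next one, since in each level that contains the circuit the
  new class spans the same set as the old one.
\<close>

lemma level_swap:
  assumes "c' = c(e := i, x := r)" and "c e = r" "c x = i" "i < r"
    and "C \<subseteq> {y \<in> level E c is. c y = i}" "x \<in> C" "e \<in> level E c is"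
    and "e \<in> cl C" "x \<in> cl (insert e (C - {x}))"
    and "set is \<subseteq> {..<r}" "j < r"
  shows "level E c' (j # is) = level E c (j # is)"
proof -
  have cl_eq: "cl {y \<in> S. c' y = k} = cl {y \<in> S. c y = k}"
    if S: "C \<subseteq> {y \<in> S. c y = i}" "e \<in> S" and k: "k < r" for S k
  proof (cases "k = i")
    case True
    let ?A = "{y \<in> S. c y = i}"
    have A': "{y \<in> S. c' y = i} = insert e (?A - {x})"
      using assms(1-4,6) S by (auto)
    have "insert e (?A - {x}) \<subseteq> cl ?A"
      using assms(8) cl_mono[OF S(1)] cl_extensive[of ?A] by blast
    moreover have "?A \<subseteq> cl (insert e (?A - {x}))"
    proof
      fix y assume y: "y \<in> ?A"
      have "insert e (C - {x}) \<subseteq> insert e (?A - {x})"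
        using S by blast
      then have "x \<in> cl (insert e (?A - {x}))"
        using assms(9) cl_mono by blast
      then show "y \<in> cl (insert e (?A - {x}))"
        using y cl_extensive[of "insert e (?A - {x})"] by (cases "y = x") auto
    qed
    ultimately show ?thesis
      unfolding True A' using cl_least by blast
  next
    case False
    then have "{y \<in> S. c' y = k} = {y \<in> S. c y = k}"
      using assms(1-4) k by auto
    then show ?thesis by simp
  qed
  show ?thesis
    using assms(5,7,10,11)
  proof (induction "is" arbitrary: j)
    case Nil
    then show ?case
      using cl_eq[of E j] by simp
  next
    case (Cons k "is")
    have "level E c' (k # is) = level E c (k # is)"
      using Cons.IH[of k] Cons.prems by auto
    then show ?case
      using cl_eq[of "level E c (k # is)" j] Cons.prems by (simp only: level.simps(2))
  qed
qed

text \<open>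
  Let \<open>e\<close> be uncoloured, in the current level, and spanned by class \<open>i\<close>
  as a whole, but not by the part of class \<open>i\<close> in the current level. At the last
  level whose part of class \<open>i\<close> still spans \<open>e\<close>, a circuit through
  \<open>e\<close> contains an element \<open>x\<close> that drops out at the next level.
  Recolouring \<open>e\<close> with \<open>i\<close> and uncolouring \<open>x\<close> keeps the
  classes independent and leaves an uncoloured element that drops out earlier than
  \<open>e\<close> did.
\<close>

lemma uncoloured_descends:
  assumes "finite E" "partial_colouring E r c" "c e = r" "i < r"
    and "e \<in> cl {x \<in> E. c x = i}"
    and "set is \<subseteq> {..<r}" "e \<in> level E c is" "e \<notin> cl {x \<in> level E c is. c x = i}"
  shows "\<exists>x js. x \<in> E \<and> c x = i \<and> partial_colouring E r (c(e := i, x := r)) \<and>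
           length js \<le> length is \<and> set js \<subseteq> {..<r} \<and> x \<notin> level E (c(e := i, x := r)) js"
  using assms(6-8)
proof (induction "is")
  case Nil
  then show ?case using assms(5) by simp
next
  case (Cons j "is")
  show ?case
  proof (cases "e \<in> cl {x \<in> level E c is. c x = i}")
    case False
    then show ?thesis
      using Cons by (auto intro: le_SucI)
  next
    case True
    have ind: "indep {x \<in> E. c x = i}"
      using assms(2,4) by (simp add: partial_colouring_def)
    have sub: "{x \<in> level E c is. c x = i} \<subseteq> {x \<in> E. c x = i}"
      using level_subset by blast
    have fin: "finite {x \<in> level E c is. c x = i}"
      using finite_subset[OF level_subset assms(1)] by simp
    obtain C x where C: "C \<subseteq> {x \<in> level E c is. c x = i}" "x \<in> C"
      "x \<notin> {x \<in> level E c (j # is). c x = i}"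
      "e \<in> cl C" "x \<in> cl (insert e (C - {x}))" "indep (insert e ({x \<in> E. c x = i} - {x}))"
      by (rule circuit_exchange[OF ind fin sub True Cons.prems(3)])
    have x: "x \<in> E" "c x = i"
      using C(1,2) level_subset by blast+
    have e: "e \<in> E"
      using Cons.prems(2) level_subset by blast
    let ?c = "c(e := i, x := r)"
    have "indep {y \<in> E. ?c y = k}" if "k < r" for k
    proof (cases "k = i")
      case True
      have "{y \<in> E. ?c y = i} = insert e ({y \<in> E. c y = i} - {x})"
        using x e assms(3,4) by auto
      then show ?thesis
        using C(6) True by simp
    next
      case False
      then have "{y \<in> E. ?c y = k} = {y \<in> E. c y = k}"
        using that x assms(3) by auto
      then show ?thesis
        using that assms(2) by (simp add: partial_colouring_def)
    qed
    moreover have "\<forall>y\<in>E. ?c y \<le> r"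
      using assms(2,4) by (auto simp: partial_colouring_def)
    ultimately have "partial_colouring E r ?c"
      by (simp add: partial_colouring_def)
    moreover have "level E ?c (j # is) = level E c (j # is)"
      using level_swap[of ?c c e i x r C E "is" j] assms(3,4) x C Cons.prems by auto
    moreover have "x \<notin> level E c (j # is)"
      using C(3) x(2) by blast
    ultimately show ?thesis
      using x Cons.prems(1) by (metis order_refl)
  qed
qed

text \<open>
  By induction on the level at which \<open>e\<close> drops out: either \<open>e\<close> can be
  added to a class directly, or \<open>uncoloured_descends\<close> replaces it by an element with
  a shorter list.
\<close>

lemma augment_colouring:
  assumes "finite E" "partial_colouring E r c" "e \<in> E" "c e = r"
    and "set is \<subseteq> {..<r}" "e \<notin> level E c is"
  shows "\<exists>c'. partial_colouring E r c' \<and> {x \<in> E. c' x < r} = insert e {x \<in> E. c x < r}"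
  using assms(2-)
proof (induction "length is" arbitrary: "is" c e rule: less_induct)
  case less
  show ?case
  proof (cases "is")
    case Nil
    then show ?thesis using less.prems by simp
  next
    case (Cons i js)
    have i: "i < r" and js: "set js \<subseteq> {..<r}"
      using less.prems Cons by auto
    show ?thesis
    proof (cases "e \<in> level E c js")
      case False
      then show ?thesis
        using less.hyps[of js c e] less.prems js Cons by simp
    next
      case True
      then have ncl: "e \<notin> cl {x \<in> level E c js. c x = i}"
        using less.prems(5) Cons by simp
      show ?thesis
      proof (cases "e \<in> cl {x \<in> E. c x = i}")
        case False
        have "indep {x \<in> E. (c(e := i)) x = k}" if "k < r" for k
        proof (cases "k = i")
          case True
          have "{x \<in> E. (c(e := i)) x = i} = insert e {x \<in> E. c x = i}"
            using less.prems(2) by auto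
          then show ?thesis
            using True False less.prems(1) i indep_insert by (simp add: partial_colouring_def)
        next
          case False
          then have "{x \<in> E. (c(e := i)) x = k} = {x \<in> E. c x = k}"
            using that less.prems(3) by auto
          then show ?thesis
            using that less.prems(1) by (simp add: partial_colouring_def)
        qed
        then have "partial_colouring E r (c(e := i))"
          using less.prems(1) i by (simp add: partial_colouring_def)
        moreover have "{x \<in> E. (c(e := i)) x < r} = insert e {x \<in> E. c x < r}"
          using less.prems(2) i by auto
        ultimately show ?thesis by blast
      next
        case ecl: True
        obtain x ks where x: "x \<in> E" "c x = i" "partial_colouring E r (c(e := i, x := r))"
          "length ks \<le> length js" "set ks \<subseteq> {..<r}" "x \<notin> level E (c(e := i, x := r)) ks"
          using uncoloured_descends[OF assms(1) less.prems(1,3) i ecl js True ncl] by blast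
        let ?c = "c(e := i, x := r)"
        obtain c' where c': "partial_colouring E r c'"
          "{y \<in> E. c' y < r} = insert x {y \<in> E. ?c y < r}"
          using less.hyps[of ks ?c x] x Cons by (auto simp: less_Suc_eq_le)
        have "insert x {y \<in> E. ?c y < r} = insert e {y \<in> E. c y < r}"
          using x(1,2) i less.prems(2,3) by auto
        then show ?thesis using c' by auto
      qed
    qed
  qed
qed

text \<open>
  Edmonds' matroid partition theorem. In a colouring with as many coloured elements as possible no
  uncoloured element drops out of any level, so a smallest level is spanned by its part of every
  class and still contains the uncoloured \<open>e\<close>.
\<close>

theorem independent_colouring_or_obstruction:
  fixes r :: nat
  assumes "finite E"
  obtains (colouring) c where "\<forall>x\<in>E. c x < r" "\<forall>i<r. indep {x \<in> E. c x = i}"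
  | (obstruction) c S e where "S \<subseteq> E" "e \<in> S" "c e = r"
      "\<forall>i<r. S \<subseteq> cl {x \<in> S. c x = i}"
proof -
  have "partial_colouring E r (\<lambda>_. r)"
    by (auto simp: partial_colouring_def indep_def)
  moreover have "\<forall>c. partial_colouring E r c \<longrightarrow> card {x \<in> E. c x < r} < Suc (card E)"
    using card_mono[OF assms] by (simp add: less_Suc_eq_le)
  ultimately have "\<exists>c. partial_colouring E r c \<and>
      (\<forall>c'. partial_colouring E r c' \<longrightarrow> card {x \<in> E. c' x < r} \<le> card {x \<in> E. c x < r})"
    by (rule ex_has_greatest_nat)
  then obtain c where c: "partial_colouring E r c"
    and max: "\<And>c'. partial_colouring E r c' \<Longrightarrow> card {x \<in> E. c' x < r} \<le> card {x \<in> E. c x < r}"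
    by auto
  show thesis
  proof (cases "\<exists>e\<in>E. c e \<ge> r")
    case False
    then show thesis
      using colouring c by (auto simp: partial_colouring_def not_le)
  next
    case True
    then obtain e where e: "e \<in> E" "c e = r"
      using c by (auto simp: partial_colouring_def intro: antisym)
    have e_level: "e \<in> level E c is" if is_r: "set is \<subseteq> {..<r}" for "is"
    proof (rule ccontr)
      assume "e \<notin> level E c is"
      then obtain c' where c': "partial_colouring E r c'"
        "{x \<in> E. c' x < r} = insert e {x \<in> E. c x < r}"
        using augment_colouring[OF assms c e is_r] by blast
      then have "card {x \<in> E. c' x < r} = Suc (card {x \<in> E. c x < r})"
        using assms e by simp
      then show False
        using max[OF c'(1)] by simp
    qed
    define is' where "is' = (ARG_MIN (\<lambda>is. card (level E c is)) is. set is \<subseteq> {..<r})"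
    have is': "set is' \<subseteq> {..<r}"
      and least: "\<And>is. set is \<subseteq> {..<r} \<Longrightarrow> card (level E c is') \<le> card (level E c is)"
      unfolding is'_def using arg_min_nat_lemma[of "\<lambda>is. set is \<subseteq> {..<r}" "[]" "\<lambda>is. card (level E c is)"] by auto
    let ?S = "level E c is'"
    have "?S \<subseteq> cl {x \<in> ?S. c x = i}" if "i < r" for i
    proof -
      have "level E c (i # is') = ?S"
        using least[of "i # is'"] is' that finite_subset[OF level_subset assms]
        by (intro card_seteq) auto
      then show ?thesis by auto
    qed
    then show thesis
      using obstruction[of ?S e c] e(2) e_level[OF is'] level_subset by blast
  qed
qed

end

section \<open>Decomposing a multigraph into forests\<close>

text \<open>
  A multigraph is given by the end points \<open>s e\<close> and \<open>t e\<close> of its edges,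
  so that parallel edges, which arise by contraction, remain distinct elements.
\<close>

definition connected_by :: "('e \<Rightarrow> 'v) \<Rightarrow> ('e \<Rightarrow> 'v) \<Rightarrow> 'e set \<Rightarrow> ('v \<times> 'v) set" where
  "connected_by s t F = (\<Union>e\<in>F. {(s e, t e), (t e, s e)})\<^sup>*"

text \<open>
  The closure operator of the graphic matroid.
\<close>

definition edge_span :: "('e \<Rightarrow> 'v) \<Rightarrow> ('e \<Rightarrow> 'v) \<Rightarrow> 'e set \<Rightarrow> 'e set" where
  "edge_span s t F = {e. (s e, t e) \<in> connected_by s t F}"

lemma connected_by_mono: "A \<subseteq> B \<Longrightarrow> connected_by s t A \<subseteq> connected_by s t B"
  unfolding connected_by_def by (intro rtrancl_mono) blast

lemma connected_by_refl: "(u, u) \<in> connected_by s t A"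
  by (simp add: connected_by_def)

lemma connected_by_trans:
  "(u, v) \<in> connected_by s t A \<Longrightarrow> (v, w) \<in> connected_by s t A \<Longrightarrow> (u, w) \<in> connected_by s t A"
  unfolding connected_by_def by (rule rtrancl_trans)

lemma connected_by_sym: "(u, v) \<in> connected_by s t A \<Longrightarrow> (v, u) \<in> connected_by s t A"
proof -
  have "sym (\<Union>e\<in>A. {(s e, t e), (t e, s e)})"
    by (auto simp: sym_def)
  then show "(u, v) \<in> connected_by s t A \<Longrightarrow> (v, u) \<in> connected_by s t A"
    unfolding connected_by_def by (meson sym_rtrancl symD)
qed

lemma connected_by_edge: "e \<in> A \<Longrightarrow> (s e, t e) \<in> connected_by s t A"
  unfolding connected_by_def by blast

lemma connected_by_least:
  assumes "A \<subseteq> edge_span s t B"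
  shows "connected_by s t A \<subseteq> connected_by s t B"
proof -
  have "(\<Union>e\<in>A. {(s e, t e), (t e, s e)}) \<subseteq> connected_by s t B"
    using assms connected_by_sym by (fastforce simp: edge_span_def)
  then show ?thesis
    unfolding connected_by_def using rtrancl_subset_rtrancl by blast
qed

text \<open>
  A walk may be shortened so that it uses the new edge \<open>x\<close> at most once.
\<close>

lemma connected_by_insert:
  assumes "(u, v) \<in> connected_by s t (insert x A)"
  shows "(u, v) \<in> connected_by s t A \<or>
    (u, s x) \<in> connected_by s t A \<and> (t x, v) \<in> connected_by s t A \<or>
    (u, t x) \<in> connected_by s t A \<and> (s x, v) \<in> connected_by s t A"
  using assms unfolding connected_by_def
proof (induction rule: rtrancl_induct)
  case base
  then show ?case by simp
next
  case (step v w)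
  let ?R = "\<Union>e\<in>A. {(s e, t e), (t e, s e)}"
  from step.hyps(2) consider "(v, w) \<in> ?R" | "v = s x" "w = t x" | "v = t x" "w = s x"
    by auto
  then show ?case
  proof cases
    case 1
    then show ?thesis using step.IH by (meson rtrancl.rtrancl_into_rtrancl)
  next
    case 2
    then show ?thesis using step.IH by blast
  next
    case 3
    then show ?thesis using step.IH by blast
  qed
qed

lemma exchange_closure_edge_span: "exchange_closure (edge_span s t)"
proof
  show ext: "A \<subseteq> edge_span s t A" for A
    by (auto simp: edge_span_def connected_by_edge)
  have "edge_span s t (edge_span s t A) \<subseteq> edge_span s t A" for A
    using connected_by_least[of "edge_span s t A" s t A] by (auto simp: edge_span_def)
  then show "edge_span s t (edge_span s t A) = edge_span s t A" for A
    using ext by (simp add: subset_antisym)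
  show "A \<subseteq> B \<Longrightarrow> edge_span s t A \<subseteq> edge_span s t B" for A B
    using connected_by_mono[of A B s t] by (auto simp: edge_span_def)
  show "x \<in> edge_span s t (insert y A)"
    if "y \<in> edge_span s t (insert x A)" "y \<notin> edge_span s t A" for x y A
  proof -
    let ?C = "connected_by s t (insert y A)"
    have sub: "connected_by s t A \<subseteq> ?C"
      by (intro connected_by_mono) auto
    have yC: "(s y, t y) \<in> ?C"
      by (simp add: connected_by_edge)
    have "(s y, s x) \<in> ?C \<and> (t x, t y) \<in> ?C \<or> (s y, t x) \<in> ?C \<and> (s x, t y) \<in> ?C"
      using connected_by_insert[of "s y" "t y" s t x A] that sub by (auto simp: edge_span_def)
    then have "(s x, t x) \<in> ?C"
      using yC connected_by_sym connected_by_trans by metis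
    then show ?thesis by (simp add: edge_span_def)
  qed
qed

abbreviation forest :: "('e \<Rightarrow> 'v) \<Rightarrow> ('e \<Rightarrow> 'v) \<Rightarrow> 'e set \<Rightarrow> bool" where
  "forest s t F \<equiv> exchange_closure.indep (edge_span s t) F"

text \<open>
  A connected set \<open>U\<close> spans at least \<open>|U| - 1\<close> edges: it is built up
  from \<open>a\<close> one vertex at a time, each new vertex coming with an edge to the vertices
  already present.
\<close>

lemma card_edges_of_connected:
  assumes "finite F" and U: "U = {v. (a, v) \<in> connected_by s t F}" and "finite U"
  shows "card U \<le> Suc (card {e \<in> F. s e \<in> U \<and> t e \<in> U})"
proof -
  have grow: "\<exists>T\<subseteq>U. a \<in> T \<and> card T = Suc n \<and> n \<le> card {e \<in> F. s e \<in> T \<and> t e \<in> T}"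
    if "n < card U" for n
    using that
  proof (induction n)
    case 0
    have "a \<in> U" by (simp add: U connected_by_refl)
    then show ?case by (intro exI[of _ "{a}"]) simp
  next
    case (Suc n)
    then obtain T where T: "T \<subseteq> U" "a \<in> T" "card T = Suc n"
      "n \<le> card {e \<in> F. s e \<in> T \<and> t e \<in> T}"
      by auto
    have finT: "finite T" using T(1) assms(3) finite_subset by blast
    have "\<exists>e\<in>F. (s e \<in> T \<and> t e \<notin> T) \<or> (t e \<in> T \<and> s e \<notin> T)"
    proof (rule ccontr)
      assume no: "\<not> ?thesis"
      have "v \<in> T" if "(a, v) \<in> connected_by s t F" for v
        using that unfolding connected_by_def
        by (induction rule: rtrancl_induct) (use T(2) no in auto)
      then have "U \<subseteq> T" by (auto simp: U)
      then show False
        using T Suc.prems card_mono[OF finT] by fastforce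
    qed
    then obtain e where eF: "e \<in> F" and cross: "s e \<in> T \<and> t e \<notin> T \<or> t e \<in> T \<and> s e \<notin> T"
      by blast
    define v where "v = (if s e \<in> T then s e else t e)"
    define w where "w = (if s e \<in> T then t e else s e)"
    have e: "v \<in> T" "w \<notin> T" "s e = v \<and> t e = w \<or> s e = w \<and> t e = v"
      using cross by (auto simp: v_def w_def)
    have "(v, w) \<in> connected_by s t F"
      using e(3) connected_by_edge[OF eF, of s t] connected_by_sym[of "s e" "t e"] by auto
    then have "w \<in> U"
      using e(1) T(1) connected_by_trans[of a v s t F w] by (auto simp: U)
    let ?F = "{e \<in> F. s e \<in> T \<and> t e \<in> T}"
    have "insert e ?F \<subseteq> {e \<in> F. s e \<in> insert w T \<and> t e \<in> insert w T}" "e \<notin> ?F"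
      using e eF by auto
    then have "Suc (card ?F) \<le> card {e \<in> F. s e \<in> insert w T \<and> t e \<in> insert w T}"
      using card_mono[of "{e \<in> F. s e \<in> insert w T \<and> t e \<in> insert w T}" "insert e ?F"] assms(1)
      by simp
    then show ?case
      using T e(2) \<open>w \<in> U\<close> finT by (intro exI[of _ "insert w T"]) auto
  qed
  have "card U > 0"
    using connected_by_refl[of a s t F] assms(3) by (auto simp: U card_gt_0_iff)
  then obtain T where T: "T \<subseteq> U" "a \<in> T" "card T = Suc (card U - 1)"
    "card U - 1 \<le> card {e \<in> F. s e \<in> T \<and> t e \<in> T}"
    using grow[of "card U - 1"] by auto
  have "card {e \<in> F. s e \<in> T \<and> t e \<in> T} \<le> card {e \<in> F. s e \<in> U \<and> t e \<in> U}"
    using T(1) assms(1) by (intro card_mono) auto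
  then show ?thesis using T(4) by linarith
qed

text \<open>
  Nash-Williams' arboricity theorem. In the obstruction of the matroid partition theorem, the
  component \<open>U\<close> of the uncoloured edge is connected within each of the
  \<open>r\<close> classes. It therefore contains \<open>r(|U| - 1)\<close> coloured edges in
  addition to the uncoloured one, which contradicts sparsity.
\<close>

theorem forest_decomposition:
  fixes s t :: "'e \<Rightarrow> 'v"
  assumes "finite E" "finite V" and ends: "\<And>e. e \<in> E \<Longrightarrow> s e \<in> V \<and> t e \<in> V"
    and sparse: "\<And>U. U \<subseteq> V \<Longrightarrow> U \<noteq> {} \<Longrightarrow>
      card {e \<in> E. s e \<in> U \<and> t e \<in> U} \<le> r * (card U - 1)"
  obtains (colouring) c where "\<forall>e\<in>E. c e < r" "\<forall>i<r. forest s t {e \<in> E. c e = i}"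
proof -
  interpret exchange_closure "edge_span s t"
    by (rule exchange_closure_edge_span)
  show thesis
  proof (rule independent_colouring_or_obstruction[OF assms(1), where r = r])
    show thesis if "\<forall>e\<in>E. c e < r" "\<forall>i<r. indep {e \<in> E. c e = i}" for c
      using that by (rule colouring)
  next
    fix c S e
    assume S: "S \<subseteq> E" and e: "e \<in> S" "c e = r"
      and spanned: "\<forall>i<r. S \<subseteq> edge_span s t {x \<in> S. c x = i}"
    define U where "U = {v. (s e, v) \<in> connected_by s t S}"
    have finS: "finite S" using S assms(1) finite_subset by blast
    have "v \<in> V" if "(s e, v) \<in> connected_by s t S" for v
      using that unfolding connected_by_def
      by (induction rule: rtrancl_induct) (use S e ends in auto)
    then have UV: "U \<subseteq> V" by (auto simp: U_def)
    then have finU: "finite U" using assms(2) finite_subset by blast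
    have eU: "s e \<in> U" "t e \<in> U"
      using e(1) by (simp_all add: U_def connected_by_refl connected_by_edge)
    let ?F = "\<lambda>i. {x \<in> S. c x = i \<and> s x \<in> U \<and> t x \<in> U}"
    have F: "card U - 1 \<le> card (?F i)" if "i < r" for i
    proof -
      have "connected_by s t S = connected_by s t {x \<in> S. c x = i}"
        using spanned that
        by (intro subset_antisym connected_by_least connected_by_mono) auto
      then have "card U \<le> Suc (card {x \<in> {x \<in> S. c x = i}. s x \<in> U \<and> t x \<in> U})"
        using card_edges_of_connected[of "{x \<in> S. c x = i}" U "s e" s t] finS finU
        by (simp add: U_def)
      then show ?thesis by simp
    qed
    have "r * (card U - 1) \<le> (\<Sum>i<r. card (?F i))"
      using sum_mono[of "{..<r}" "\<lambda>_. card U - 1" "\<lambda>i. card (?F i)"] F by simp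
    also have "\<dots> = card (\<Union>i<r. ?F i)"
      using finS by (intro card_UN_disjoint[symmetric]) auto
    also have "\<dots> < card (insert e (\<Union>i<r. ?F i))"
      using finS e(2) by (intro psubset_card_mono) auto
    also have "\<dots> \<le> card {x \<in> E. s x \<in> U \<and> t x \<in> U}"
      using S e(1) eU assms(1) by (intro card_mono) auto
    finally have "r * (card U - 1) < card {x \<in> E. s x \<in> U \<and> t x \<in> U}" .
    moreover have "U \<noteq> {}"
      using eU by blast
    ultimately have False
      using sparse[OF UV] by (simp add: leD)
    then show thesis ..
  qed
qed

section \<open>Copies of cycles and the maximum density\<close>

lemma contains_cycle_iff:
  "contains_copy G (cycle_graph l) \<longleftrightarrow>
     (\<exists>\<phi>. inj_on \<phi> {..<l} \<and> \<phi> ` {..<l} \<subseteq> verts G \<and> (\<forall>k<l. {\<phi> k, \<phi> (Suc k mod l)} \<in> edges G))"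
proof -
  have "edges (cycle_graph l) = (\<lambda>k. {k, Suc k mod l}) ` {..<l}" "verts (cycle_graph l) = {..<l}"
    by (auto simp: cycle_graph_def)
  then show ?thesis
    by (simp add: contains_copy_def lessThan_iff[symmetric] Ball_def[symmetric] del: lessThan_iff)
qed

lemma contains_cycleI:
  assumes "distinct zs" "length zs = l" "zs \<noteq> []" "set zs \<subseteq> verts G"
    and "successively (\<lambda>x y. {x, y} \<in> edges G) zs" "{last zs, hd zs} \<in> edges G"
  shows "contains_copy G (cycle_graph l)"
  unfolding contains_cycle_iff
proof (intro exI conjI allI impI)
  show "inj_on ((!) zs) {..<l}"
    using assms(1,2) by (simp add: inj_on_nth)
  show "(!) zs ` {..<l} \<subseteq> verts G"
    using assms(2,4) by auto
  fix k assume "k < l"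
  show "{zs ! k, zs ! (Suc k mod l)} \<in> edges G"
  proof (cases "Suc k < l")
    case True
    then show ?thesis
      using assms(2,5) by (simp add: successively_conv_nth)
  next
    case False
    then have "k = l - 1" "Suc k mod l = 0"
      using \<open>k < l\<close> by (auto simp: not_less le_Suc_eq)
    then show ?thesis
      using assms(2,3,6) by (simp add: last_conv_nth hd_conv_nth)
  qed
qed

text \<open>
  For \<open>l = 2\<close> the edges from \<open>0\<close> to \<open>1\<close> and back coincide,
  hence the bound on \<open>l\<close>.
\<close>

lemma cycle_edge_inj:
  assumes "l \<ge> 3" "inj_on \<phi> {..<l}" "j < l" "k < l"
    and "{\<phi> j, \<phi> (Suc j mod l)} = {\<phi> k, \<phi> (Suc k mod l)}"
  shows "j = k"
proof -
  have lt: "Suc j mod l < l" "Suc k mod l < l"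
    using assms(1) by simp_all
  consider "\<phi> j = \<phi> k" | "\<phi> j = \<phi> (Suc k mod l)" "\<phi> (Suc j mod l) = \<phi> k"
    using assms(5) by (auto simp: doubleton_eq_iff)
  then show ?thesis
  proof cases
    case 1
    then show ?thesis using assms(2-4) by (auto dest: inj_onD)
  next
    case 2
    then have "j = Suc k mod l" "Suc j mod l = k"
      using inj_onD[OF assms(2)] assms(3,4) lt by auto
    then have "Suc (Suc k) mod l = k"
      by (simp add: mod_Suc_eq)
    then show ?thesis
      using assms(1,4) by (cases "Suc (Suc k) < l") (auto simp: mod_if split: if_splits)
  qed
qed

lemma not_RamseyI:
  assumes "\<And>e. e \<in> edges G \<Longrightarrow> c e < r"
    and "\<And>i \<phi>. inj_on \<phi> {..<l} \<Longrightarrow> \<phi> ` {..<l} \<subseteq> verts G \<Longrightarrow>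
      \<forall>k<l. {\<phi> k, \<phi> (Suc k mod l)} \<in> edges G \<and> c {\<phi> k, \<phi> (Suc k mod l)} = i \<Longrightarrow> False"
  shows "\<not> is_Ramsey (cycle_graph l) r G"
proof
  assume "is_Ramsey (cycle_graph l) r G"
  moreover have "c \<in> edges G \<rightarrow> {..<r}"
    using assms(1) by auto
  ultimately obtain i where "contains_copy (colour_class G c i) (cycle_graph l)"
    unfolding is_Ramsey_def by blast
  then obtain \<phi> where "inj_on \<phi> {..<l}" "\<phi> ` {..<l} \<subseteq> verts G"
    "\<forall>k<l. {\<phi> k, \<phi> (Suc k mod l)} \<in> edges G \<and> c {\<phi> k, \<phi> (Suc k mod l)} = i"
    unfolding contains_cycle_iff by (auto simp: colour_class_def)
  then show False by (rule assms(2))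
qed

lemma simple_graph_finite:
  assumes "simple_graph G"
  shows "finite (verts G)" "finite (edges G)"
  using assms finite_subset[OF _ finite_imp_finite_nsets] by (auto simp: simple_graph_def)

lemma simple_graph_edgeE:
  assumes "simple_graph G" "e \<in> edges G"
  obtains x y where "e = {x, y}" "x \<noteq> y" "x \<in> verts G" "y \<in> verts G"
proof -
  have "e \<subseteq> verts G" "card e = 2"
    using assms by (auto simp: simple_graph_def nsets_def)
  then show thesis
    using that by (auto simp: card_2_iff)
qed

lemma card_induced_le_max_density:
  assumes "simple_graph G" "W \<subseteq> verts G" "W \<noteq> {}"
  shows "real (card {e \<in> edges G. e \<subseteq> W}) \<le> max_density G * real (card W)"
proof -
  let ?H = "\<lparr>verts = W, edges = {e \<in> edges G. e \<subseteq> W}\<rparr>"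
  have fin: "finite W"
    using assms simple_graph_finite(1) finite_subset by blast
  have "subgraph ?H G"
    using assms fin by (auto simp: subgraph_def simple_graph_def nsets_def)
  moreover have "verts G \<noteq> {}"
    using assms by blast
  ultimately have "real (card (edges ?H)) / real (card (verts ?H)) \<le> max_density G"
    unfolding max_density_def
    using assms by (intro Max_ge max_density_set(1)[OF assms(1)] CollectI exI[of _ ?H]) auto
  then show ?thesis
    using fin assms(3) by (simp add: pos_divide_le_eq card_gt_0_iff)
qed

lemma max_density_less:
  assumes "simple_graph G" "verts G \<noteq> {}"
    and "\<And>W. W \<subseteq> verts G \<Longrightarrow> W \<noteq> {} \<Longrightarrow> real (card {e \<in> edges G. e \<subseteq> W}) < d * real (card W)"
  shows "max_density G < d"
proof -
  have "real (card (edges H)) / real (card (verts H)) < d"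
    if H: "subgraph H G" "verts H \<noteq> {}" for H
  proof -
    have W: "verts H \<subseteq> verts G" and "edges H \<subseteq> {e \<in> edges G. e \<subseteq> verts H}"
      using H(1) by (auto simp: subgraph_def simple_graph_def nsets_def)
    then have "card (edges H) \<le> card {e \<in> edges G. e \<subseteq> verts H}"
      using simple_graph_finite(2)[OF assms(1)] by (intro card_mono) auto
    then have "real (card (edges H)) < d * real (card (verts H))"
      using assms(3)[OF W H(2)] by linarith
    moreover have "finite (verts H)"
      using H(1) by (simp add: subgraph_def simple_graph_def)
    ultimately show ?thesis
      using H(2) by (simp add: pos_divide_less_eq card_gt_0_iff)
  qed
  then show ?thesis
    unfolding max_density_def
    using max_density_set[OF assms(1,2)] by (subst Max_less_iff) auto
qed

lemma Ramsey_density_le: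
  fixes G :: "nat graph"
  assumes "simple_graph F" "verts F \<noteq> {}" "simple_graph G" "is_Ramsey F r G"
  shows "Ramsey_density F r \<le> max_density G"
  unfolding Ramsey_density_def
  using assms by (intro cInf_lower Ramsey_density_set(2)) auto

lemma Ramsey_density_ge:
  assumes "simple_graph F" "verts F \<noteq> {}"
    and "\<And>G :: nat graph. simple_graph G \<Longrightarrow> max_density G < d \<Longrightarrow> \<not> is_Ramsey F r G"
  shows "d \<le> Ramsey_density F r"
  unfolding Ramsey_density_def
  by (intro cInf_greatest Ramsey_density_set(1)[OF assms(1,2)]) (auto intro!: leI dest: assms(3))

section \<open>Lower bound by forests\<close>

lemma Ramsey_number_ge:
  assumes "l \<ge> 3" "r \<ge> 1"
  shows "l \<le> Ramsey_number (cycle_graph l) r"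
proof -
  let ?R = "Ramsey_number (cycle_graph l) r"
  have "is_Ramsey (cycle_graph l) r (complete_graph ?R)"
    unfolding Ramsey_number_def
    by (rule LeastI_ex) (rule complete_graph_is_Ramsey[OF simple_cycle_graph[OF assms(1)]])
  moreover have "(\<lambda>_. 0) \<in> edges (complete_graph ?R) \<rightarrow> {..<r}"
    using assms(2) by simp
  ultimately obtain i where "contains_copy (colour_class (complete_graph ?R) (\<lambda>_. 0) i) (cycle_graph l)"
    unfolding is_Ramsey_def by blast
  then obtain \<phi> where "inj_on \<phi> {..<l}" "\<phi> ` {..<l} \<subseteq> {..<?R}"
    unfolding contains_cycle_iff by (auto simp: colour_class_def complete_graph_def)
  then have "card {..<l} \<le> card {..<?R}"
    by (intro card_inj_on_le) auto
  then show ?thesis by simp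
qed

text \<open>
  The colouring of a small complete graph, transported to an arbitrary vertex set. The colours are
  bounded on all sets, also on those that are not pairs in \<open>W\<close>, so that such
  colourings can be combined without side conditions.
\<close>

lemma small_set_colouring:
  assumes "r \<ge> 1" "finite W" "card W < Ramsey_number (cycle_graph l) r"
  obtains c :: "'a set \<Rightarrow> nat" where "\<And>e. c e < r"
    "\<And>i \<phi>. inj_on \<phi> {..<l} \<Longrightarrow> \<phi> ` {..<l} \<subseteq> W \<Longrightarrow>
      \<forall>k<l. \<phi> k \<noteq> \<phi> (Suc k mod l) \<and> c {\<phi> k, \<phi> (Suc k mod l)} = i \<Longrightarrow> False"
proof -
  let ?K = "complete_graph (card W)"
  have "\<not> is_Ramsey (cycle_graph l) r ?K"
    using assms(3) unfolding Ramsey_number_def by (rule not_less_Least)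
  then obtain c0 where c0: "c0 \<in> edges ?K \<rightarrow> {..<r}"
    "\<And>i. i < r \<Longrightarrow> \<not> contains_copy (colour_class ?K c0 i) (cycle_graph l)"
    unfolding is_Ramsey_def by blast
  obtain h where h: "bij_betw h W {..<card W}"
    using finite_same_card_bij[of W "{..<card W}"] assms(2) by auto
  define c where "c = (\<lambda>e. if h ` e \<in> edges ?K then c0 (h ` e) else 0)"
  show thesis
  proof (rule that)
    show "c e < r" for e
      using c0(1) assms(1) by (auto simp: c_def)
    fix i \<phi>
    assume \<phi>: "inj_on \<phi> {..<l}" "\<phi> ` {..<l} \<subseteq> W"
      and mono: "\<forall>k<l. \<phi> k \<noteq> \<phi> (Suc k mod l) \<and> c {\<phi> k, \<phi> (Suc k mod l)} = i"
    have edge: "{(h \<circ> \<phi>) k, (h \<circ> \<phi>) (Suc k mod l)} \<in> edges (colour_class ?K c0 i)" if "k < l" for k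
    proof -
      have "Suc k mod l < l"
        using that by simp
      then have W: "\<phi> k \<in> W" "\<phi> (Suc k mod l) \<in> W" "\<phi> k \<noteq> \<phi> (Suc k mod l)"
        using \<phi>(2) mono that by auto
      then have "h (\<phi> k) \<noteq> h (\<phi> (Suc k mod l))" "h (\<phi> k) < card W" "h (\<phi> (Suc k mod l)) < card W"
        using bij_betw_imp_inj_on[OF h] bij_betwE[OF h] by (auto dest: inj_onD)
      then have "h ` {\<phi> k, \<phi> (Suc k mod l)} \<in> edges ?K"
        by (simp add: complete_graph_def)
      moreover from this have "c0 (h ` {\<phi> k, \<phi> (Suc k mod l)}) = i"
        using mono that by (auto simp: c_def)
      ultimately show ?thesis
        by (simp add: colour_class_def)
    qed
    have "inj_on (h \<circ> \<phi>) {..<l}"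
      using \<phi> bij_betw_imp_inj_on[OF h] by (intro comp_inj_on) (auto intro: inj_on_subset)
    moreover have "(h \<circ> \<phi>) ` {..<l} \<subseteq> verts (colour_class ?K c0 i)"
      using \<phi>(2) bij_betwE[OF h] by (auto simp: colour_class_def complete_graph_def)
    ultimately have copy: "contains_copy (colour_class ?K c0 i) (cycle_graph l)"
      unfolding contains_cycle_iff using edge by blast
    have "l > 0"
    proof (rule ccontr)
      assume "\<not> l > 0"
      then have "contains_copy (colour_class ?K c0 0) (cycle_graph l)"
        unfolding contains_cycle_iff by simp
      then show False
        using c0(2)[of 0] assms(1) by simp
    qed
    then have "i < r"
      using \<open>\<And>e. c e < r\<close> mono by blast
    then show False
      using c0(2) copy by blast
  qed
qed

lemma partition_merge:
  assumes "partition_on V P" "S \<subseteq> P" "S \<noteq> {}"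
  shows "partition_on V (insert (\<Union>S) (P - S))"
proof -
  obtain A where "A \<in> S"
    using assms(3) by blast
  then have "A \<noteq> {}" "A \<subseteq> \<Union>S"
    using assms(2) partition_onD3[OF assms(1)] by blast+
  then have "\<Union>S \<noteq> {}"
    by blast
  moreover have "\<Union>(insert (\<Union>S) (P - S)) = V"
    using assms by (auto simp: partition_on_def)
  moreover have "disjoint (insert (\<Union>S) (P - S))"
  proof (rule disjointI)
    have dis: "A \<inter> B = {}" if "A \<in> P" "B \<in> P" "A \<noteq> B" for A B
      using that partition_onD2[OF assms(1)] by (auto dest: disjointD)
    then have "\<Union>S \<inter> B = {}" if "B \<in> P - S" for B
      using that assms(2) by blast
    then show "A \<inter> B = {}"
      if "A \<in> insert (\<Union>S) (P - S)" "B \<in> insert (\<Union>S) (P - S)" "A \<noteq> B" for A B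
      using that dis by blast
  qed
  ultimately show ?thesis
    using assms(1) by (auto simp: partition_on_def)
qed

text \<open>
  Among the partitions of the vertices into blocks with fewer than \<open>R(C\<^sub>l, r)\<close>
  vertices that each carry at least \<open>r(|A| - 1)\<close> edges, one with the fewest blocks is
  contracted. If a family of blocks violated Nash-Williams' condition in the contracted
  multigraph, then its union would violate it in \<open>G\<close>, hence be small, and merging the
  family would give a partition with fewer blocks.
\<close>

theorem sparse_not_Ramsey:
  fixes G :: "nat graph"
  assumes G: "simple_graph G" and "l \<ge> 3" "r \<ge> 1"
    and dense_small: "\<And>W. W \<subseteq> verts G \<Longrightarrow> W \<noteq> {} \<Longrightarrow>
      r * (card W - 1) < card {e \<in> edges G. e \<subseteq> W} \<Longrightarrow> card W < Ramsey_number (cycle_graph l) r"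
  shows "\<not> is_Ramsey (cycle_graph l) r G"
proof -
  let ?V = "verts G" and ?E = "edges G" and ?R = "Ramsey_number (cycle_graph l) r"
  note fin = simple_graph_finite[OF G]
  define inside where "inside W = {e \<in> ?E. e \<subseteq> W}" for W
  have fin_inside: "finite (inside W)" for W
    using fin by (simp add: inside_def)
  define good where "good P \<longleftrightarrow> partition_on ?V P \<and>
    (\<forall>A\<in>P. r * (card A - 1) \<le> card (inside A) \<and> card A < ?R)" for P
  have "good ((\<lambda>v. {v}) ` ?V)"
  proof -
    have "partition_on ?V ((\<lambda>v. {v}) ` ?V)"
      by (auto simp: partition_on_def disjoint_def)
    then show ?thesis
      using Ramsey_number_ge[OF assms(2,3)] assms(2) by (auto simp: good_def)
  qed
  then obtain P where P: "good P" and min: "\<And>P'. good P' \<Longrightarrow> card P \<le> card P'"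
    using ex_has_least_nat[of good _ card] by blast
  have part: "partition_on ?V P"
    using P by (simp add: good_def)
  have finP: "finite P"
    using part fin(1) by (rule finite_elements[rotated])
  define blk where "blk v = (THE A. A \<in> P \<and> v \<in> A)" for v
  have blk_eq: "blk v = A" if "A \<in> P" "v \<in> A" for v A
    unfolding blk_def using that partition_onD2[OF part]
    by (intro the_equality) (auto dest: disjointD)
  have blk: "blk v \<in> P" "v \<in> blk v" if "v \<in> ?V" for v
    using partition_onD1[OF part] that blk_eq by auto
  (* The order of the vertices serves only to tell the two ends of an edge apart. *)
  define s where "s e = blk (Min e)" for e :: "nat set"
  define t where "t e = blk (Max e)" for e :: "nat set"
  have st: "s {x, y} = blk x \<and> t {x, y} = blk y \<or> s {x, y} = blk y \<and> t {x, y} = blk x" for x y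
    by (auto simp: s_def t_def min_def max_def)
  define cross where "cross = {e \<in> ?E. s e \<noteq> t e}"
  have ends: "s e \<in> P \<and> t e \<in> P" if "e \<in> cross" for e
    using that st blk by (auto simp: cross_def elim!: simple_graph_edgeE[OF G]) metis+
  have cross_sparse: "card {e \<in> cross. s e \<in> S \<and> t e \<in> S} \<le> r * (card S - 1)"
    if S: "S \<subseteq> P" "S \<noteq> {}" for S
  proof (rule ccontr)
    let ?C = "{e \<in> cross. s e \<in> S \<and> t e \<in> S}"
    assume "\<not> card ?C \<le> r * (card S - 1)"
    then have many: "r * (card S - 1) < card ?C"
      by simp
    have finS: "finite S"
      using S(1) finP finite_subset by blast
    have "card S \<noteq> 1"
    proof
      assume "card S = 1"
      then obtain A where "S = {A}"
        by (auto simp: card_1_singleton_iff)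
      then have "?C = {}"
        by (auto simp: cross_def)
      then have "card ?C = 0"
        by (simp only: card.empty)
      then show False
        using many by linarith
    qed
    then have S2: "card S \<ge> 2"
      using S(2) finS card_gt_0_iff[of S] by linarith
    have dis: "A \<inter> B = {}" if "A \<in> S" "B \<in> S" "A \<noteq> B" for A B
      using that S(1) partition_onD2[OF part] by (auto dest: disjointD)
    have block: "finite A" "A \<noteq> {}" "r * (card A - 1) \<le> card (inside A)" if "A \<in> S" for A
    proof -
      have "A \<subseteq> ?V"
        using that S(1) partition_onD1[OF part] by blast
      then show "finite A"
        using fin(1) finite_subset by blast
      show "A \<noteq> {}"
        using that S(1) partition_onD3[OF part] by blast
      show "r * (card A - 1) \<le> card (inside A)"
        using that S(1) P by (auto simp: good_def)
    qed
    have UV: "\<Union>S \<subseteq> ?V"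
      using S partition_onD1[OF part] by auto
    obtain A where "A \<in> S"
      using S(2) by blast
    then have Une: "\<Union>S \<noteq> {}"
      using block(2) by blast
    have card_U: "card (\<Union>S) = (\<Sum>A\<in>S. card A)"
      using block(1) dis by (intro card_Union_disjoint) (auto simp: pairwise_def disjnt_def)
    have "(\<Sum>A\<in>S. card A) = (\<Sum>A\<in>S. (card A - 1) + 1)"
      using block by (intro sum.cong) (auto simp: Suc_le_eq card_gt_0_iff)
    also have "\<dots> = (\<Sum>A\<in>S. card A - 1) + card S"
      by (subst sum.distrib) simp
    finally have "card (\<Union>S) - 1 = (\<Sum>A\<in>S. card A - 1) + (card S - 1)"
      using card_U S2 by linarith
    then have "r * (card (\<Union>S) - 1) = (\<Sum>A\<in>S. r * (card A - 1)) + r * (card S - 1)"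
      by (simp add: distrib_left sum_distrib_left)
    also have "\<dots> < (\<Sum>A\<in>S. card (inside A)) + card ?C"
      using many by (intro add_le_less_mono sum_mono block(3)) auto
    also have "(\<Sum>A\<in>S. card (inside A)) = card (\<Union>A\<in>S. inside A)"
    proof (rule card_UN_disjoint[symmetric])
      have "inside A \<inter> inside B = {}" if "A \<inter> B = {}" for A B
        using that by (auto simp: inside_def elim!: simple_graph_edgeE[OF G])
      then show "\<forall>A\<in>S. \<forall>B\<in>S. A \<noteq> B \<longrightarrow> inside A \<inter> inside B = {}"
        using dis by blast
    qed (use finS fin_inside in auto)
    also have "\<dots> + card ?C = card ((\<Union>A\<in>S. inside A) \<union> ?C)"
    proof (rule card_Un_disjoint[symmetric])
      have "e \<notin> cross" if "e \<in> inside A" "A \<in> S" for e A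
      proof -
        have e: "e \<in> ?E" "e \<subseteq> A" "A \<in> P"
          using that S(1) by (auto simp: inside_def)
        obtain x y where "e = {x, y}"
          using simple_graph_edgeE[OF G e(1)] by metis
        then show ?thesis
          using e(2) st[of x y] blk_eq[OF e(3)] by (auto simp: cross_def)
      qed
      then show "(\<Union>A\<in>S. inside A) \<inter> ?C = {}"
        by blast
    qed (use finS fin_inside fin(2) in \<open>auto simp: cross_def\<close>)
    also have "\<dots> \<le> card (inside (\<Union>S))"
    proof (intro card_mono fin_inside)
      have "e \<subseteq> \<Union>S" if "e \<in> ?C" for e
      proof -
        have e: "e \<in> ?E" "s e \<in> S" "t e \<in> S"
          using that by (auto simp: cross_def)
        obtain x y where xy: "e = {x, y}" "x \<in> ?V" "y \<in> ?V"
          using simple_graph_edgeE[OF G e(1)] by metis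
        have "blk x \<in> S" "blk y \<in> S"
          using e(2,3) st[of x y] unfolding xy(1) by auto
        then show ?thesis
          using xy blk(2) by blast
      qed
      then show "(\<Union>A\<in>S. inside A) \<union> ?C \<subseteq> inside (\<Union>S)"
        by (auto simp: inside_def cross_def)
    qed
    finally have dense: "r * (card (\<Union>S) - 1) < card (inside (\<Union>S))" .
    then have "card (\<Union>S) < ?R"
      using dense_small[OF UV Une] by (simp add: inside_def)
    then have "good (insert (\<Union>S) (P - S))"
      using partition_merge[OF part S] P dense by (auto simp: good_def)
    then have "card P \<le> card (insert (\<Union>S) (P - S))"
      by (rule min)
    also have "\<dots> \<le> Suc (card (P - S))"
      by (rule card_insert_le_m1[THEN order_trans]) auto
    also have "\<dots> = Suc (card P - card S)"
      using finS S(1) by (simp add: card_Diff_subset)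
    finally show False
      using S2 card_mono[OF finP S(1)] by linarith
  qed
  have "finite cross"
    using fin(2) by (simp add: cross_def)
  then obtain cx where cx: "\<forall>e\<in>cross. cx e < r" "\<forall>i<r. forest s t {e \<in> cross. cx e = i}"
    using finP ends cross_sparse by (rule forest_decomposition)
  have "\<forall>A\<in>P. \<exists>c. (\<forall>e. c e < r) \<and> (\<forall>i \<phi>. inj_on \<phi> {..<l} \<longrightarrow> \<phi> ` {..<l} \<subseteq> A \<longrightarrow>
      \<not> (\<forall>k<l. \<phi> k \<noteq> \<phi> (Suc k mod l) \<and> c {\<phi> k, \<phi> (Suc k mod l)} = i))"
  proof
    fix A assume A: "A \<in> P"
    then have "A \<subseteq> ?V"
      using partition_onD1[OF part] by blast
    then have "finite A"
      using fin(1) finite_subset by blast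
    moreover have "card A < ?R"
      using A P by (auto simp: good_def)
    ultimately obtain c :: "nat set \<Rightarrow> nat" where "\<And>e. c e < r"
      "\<And>i \<phi>. inj_on \<phi> {..<l} \<Longrightarrow> \<phi> ` {..<l} \<subseteq> A \<Longrightarrow>
        \<forall>k<l. \<phi> k \<noteq> \<phi> (Suc k mod l) \<and> c {\<phi> k, \<phi> (Suc k mod l)} = i \<Longrightarrow> False"
      using small_set_colouring[OF assms(3)] by blast
    then show "\<exists>c. (\<forall>e. c e < r) \<and> (\<forall>i \<phi>. inj_on \<phi> {..<l} \<longrightarrow> \<phi> ` {..<l} \<subseteq> A \<longrightarrow>
        \<not> (\<forall>k<l. \<phi> k \<noteq> \<phi> (Suc k mod l) \<and> c {\<phi> k, \<phi> (Suc k mod l)} = i))"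
      by blast
  qed
  then obtain cb where cb: "\<And>A e. A \<in> P \<Longrightarrow> cb A e < r"
    and cb_mono: "\<And>A i \<phi>. A \<in> P \<Longrightarrow> inj_on \<phi> {..<l} \<Longrightarrow> \<phi> ` {..<l} \<subseteq> A \<Longrightarrow>
      \<forall>k<l. \<phi> k \<noteq> \<phi> (Suc k mod l) \<and> cb A {\<phi> k, \<phi> (Suc k mod l)} = i \<Longrightarrow> False"
    by (metis (no_types))
  (* For an edge inside a block, s e is that block. *)
  define c where "c e = (if e \<in> cross then cx e else cb (s e) e)" for e
  show ?thesis
  proof (rule not_RamseyI[where c = c])
    show "c e < r" if e: "e \<in> ?E" for e
    proof (cases "e \<in> cross")
      case True
      then show ?thesis using cx(1) by (simp add: c_def)
    next
      case False
      obtain x y where "e = {x, y}" "x \<in> ?V" "y \<in> ?V"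
        using simple_graph_edgeE[OF G e] by metis
      then have "s e \<in> P"
        using st[of x y] blk(1) by auto
      then show ?thesis
        using False cb by (simp add: c_def)
    qed
  next
    fix i \<phi>
    assume inj: "inj_on \<phi> {..<l}" and \<phi>V: "\<phi> ` {..<l} \<subseteq> ?V"
      and mono: "\<forall>k<l. {\<phi> k, \<phi> (Suc k mod l)} \<in> ?E \<and> c {\<phi> k, \<phi> (Suc k mod l)} = i"
    let ?e = "\<lambda>k. {\<phi> k, \<phi> (Suc k mod l)}"
    have "l > 0" using assms(2) by simp
    have neq: "\<phi> k \<noteq> \<phi> (Suc k mod l)" if "k < l" for k
      using mono that by (metis simple_graph_edgeE[OF G] doubleton_eq_iff)
    have not_cross: "blk (\<phi> k) = blk (\<phi> (Suc k mod l))" if "k < l" "?e k \<notin> cross" for k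
      using that mono st[of "\<phi> k" "\<phi> (Suc k mod l)"] by (auto simp: cross_def)
    show False
    proof (cases "\<exists>k<l. ?e k \<in> cross")
      case False
      have same: "blk (\<phi> k) = blk (\<phi> 0)" if "k < l" for k
        using that
      proof (induction k)
        case (Suc k)
        then have "k < l" "Suc k mod l = Suc k"
          by simp_all
        moreover from this have "?e k \<notin> cross"
          using False by blast
        ultimately show ?case
          using not_cross[of k] Suc by simp
      qed simp
      have block: "blk (\<phi> 0) \<in> P"
        using blk(1) \<phi>V \<open>l > 0\<close> by blast
      have "\<phi> k \<in> blk (\<phi> 0)" if "k < l" for k
        using blk(2)[of "\<phi> k"] \<phi>V that same[OF that] by auto
      then have "\<phi> ` {..<l} \<subseteq> blk (\<phi> 0)"
        by auto
      moreover have "\<phi> k \<noteq> \<phi> (Suc k mod l) \<and> cb (blk (\<phi> 0)) (?e k) = i" if "k < l" for k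
      proof -
        have "s (?e k) = blk (\<phi> 0)"
          using st[of "\<phi> k" "\<phi> (Suc k mod l)"] same[OF that] same[of "Suc k mod l"] \<open>l > 0\<close>
          by auto
        moreover have "c (?e k) = i" "?e k \<notin> cross"
          using mono that False by auto
        ultimately show ?thesis
          using neq[OF that] by (simp add: c_def)
      qed
      ultimately show False
        by (intro cb_mono[OF block inj, of i]) auto
    next
      case True
      then obtain k where k: "k < l" "?e k \<in> cross"
        by blast
      define F where "F = {e \<in> cross. cx e = i}"
      let ?conn = "connected_by s t (F - {?e k})"
      have kF: "?e k \<in> F"
        using k mono by (auto simp: F_def c_def)
      then have "i < r"
        using cx(1) by (auto simp: F_def)
      have step: "(blk (\<phi> j), blk (\<phi> (Suc j mod l))) \<in> ?conn" if "j < l" "j \<noteq> k" for j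
      proof (cases "?e j \<in> cross")
        case True
        have "?e j \<noteq> ?e k"
          using cycle_edge_inj[OF assms(2) inj that(1) k(1)] that(2) by blast
        then have "?e j \<in> F - {?e k}"
          using True mono that(1) by (auto simp: F_def c_def)
        then have "(s (?e j), t (?e j)) \<in> ?conn"
          by (rule connected_by_edge)
        then show ?thesis
          using st[of "\<phi> j" "\<phi> (Suc j mod l)"] connected_by_sym by auto
      next
        case False
        then show ?thesis
          using not_cross[OF that(1)] by (simp add: connected_by_refl)
      qed
      have "(blk (\<phi> (Suc k mod l)), blk (\<phi> ((Suc k + n) mod l))) \<in> ?conn" if "n < l" for n
        using that
      proof (induction n)
        case 0
        then show ?case by (simp add: connected_by_refl)
      next
        case (Suc n)
        let ?j = "(Suc k + n) mod l"
        have "?j \<noteq> k"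
        proof
          assume "?j = k"
          then have "(k + Suc n) mod l = (k + 0) mod l"
            using k(1) by simp
          then have "l dvd Suc n"
            using mod_eq_dvd_iff_nat[of k "k + Suc n" l] by simp
          then show False
            using Suc.prems by (auto dest: dvd_imp_le)
        qed
        then have "(blk (\<phi> ?j), blk (\<phi> (Suc ?j mod l))) \<in> ?conn"
          using step[of ?j] \<open>l > 0\<close> by simp
        moreover have "Suc ?j mod l = (Suc k + Suc n) mod l"
          by (simp add: mod_Suc_eq)
        moreover have "(blk (\<phi> (Suc k mod l)), blk (\<phi> ?j)) \<in> ?conn"
          using Suc by simp
        ultimately show ?case
          using connected_by_trans by metis
      qed
      from this[of "l - 1"] have "(blk (\<phi> (Suc k mod l)), blk (\<phi> k)) \<in> ?conn"
        using \<open>l > 0\<close> k(1) by simp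
      then have "(s (?e k), t (?e k)) \<in> ?conn"
        using st[of "\<phi> k" "\<phi> (Suc k mod l)"] connected_by_sym by auto
      then have "?e k \<in> edge_span s t (F - {?e k})"
        by (simp add: edge_span_def)
      moreover have "forest s t F"
        using cx(2) \<open>i < r\<close> by (simp add: F_def)
      ultimately show False
        using kF by (auto simp: exchange_closure.indep_def[OF exchange_closure_edge_span])
    qed
  qed
qed

text \<open>
  The two arguments of the maximum have different purposes: sets with at most \<open>2r\<close>
  vertices satisfy Nash-Williams' condition because they have only \<open>|W|(|W| - 1)/2\<close>
  pairs, and sets with fewer than \<open>R(C\<^sub>l, r)\<close> vertices are allowed to violate
  it. All others are sparse by the bound on the density.
\<close>

lemma cycle_lower_bound:
  assumes "l \<ge> 3" "r \<ge> 1"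
  shows "real r - (real r - 1) / real (max (Ramsey_number (cycle_graph l) r) (2 * r + 1))
    \<le> Ramsey_density (cycle_graph l) r"
proof (rule Ramsey_density_ge)
  let ?R = "Ramsey_number (cycle_graph l) r"
  let ?N = "max ?R (2 * r + 1)"
  fix G :: "nat graph"
  assume G: "simple_graph G" and less: "max_density G < real r - (real r - 1) / real ?N"
  show "\<not> is_Ramsey (cycle_graph l) r G"
  proof (rule sparse_not_Ramsey[OF G assms])
    fix W assume W: "W \<subseteq> verts G" "W \<noteq> {}"
      and dense: "r * (card W - 1) < card {e \<in> edges G. e \<subseteq> W}"
    let ?e = "card {e \<in> edges G. e \<subseteq> W}"
    have finW: "finite W"
      using W simple_graph_finite(1)[OF G] finite_subset by blast
    then have posW: "card W > 0"
      using W(2) by (simp add: card_gt_0_iff)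
    have "\<not> ?N \<le> card W"
    proof
      assume N: "?N \<le> card W"
      have "real ?e \<le> max_density G * real (card W)"
        by (rule card_induced_le_max_density[OF G W])
      also have "\<dots> < (real r - (real r - 1) / real ?N) * real (card W)"
        using less posW by simp
      also have "\<dots> = real r * real (card W) - (real r - 1) * (real (card W) / real ?N)"
        by (simp add: field_simps)
      also have "\<dots> \<le> real r * real (card W) - (real r - 1) * 1"
        using N assms(2) by (intro diff_left_mono mult_left_mono) (auto simp: le_divide_eq)
      also have "\<dots> = real (r * (card W - 1) + 1)"
        using posW by (simp add: of_nat_diff algebra_simps)
      finally show False
        using dense by linarith
    qed
    moreover have "2 * r + 1 \<le> card W"
    proof (rule ccontr)
      assume "\<not> 2 * r + 1 \<le> card W"
      have "{e \<in> edges G. e \<subseteq> W} \<subseteq> [W]\<^bsup>2\<^esup>"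
        using G by (auto simp: simple_graph_def nsets_def)
      then have "?e \<le> card ([W]\<^bsup>2\<^esup>)"
        using finW finite_imp_finite_nsets by (intro card_mono) auto
      then have "2 * ?e \<le> card W * (card W - 1)"
        by (simp add: card_nsets choose_two)
      also have "\<dots> \<le> 2 * r * (card W - 1)"
        using \<open>\<not> 2 * r + 1 \<le> card W\<close> by (intro mult_right_mono) auto
      finally show False
        using dense by simp
    qed
    ultimately show "card W < ?R"
      by linarith
  qed
qed (use assms simple_cycle_graph in \<open>auto simp: cycle_graph_def lessThan_empty_iff\<close>)

section \<open>Lower bound for odd cycles by bipartite colour classes\<close>

text \<open>
  The average degree in every induced subgraph is below \<open>k\<close>, so a vertex of degree
  less than \<open>k\<close> can be removed and coloured last.
\<close>

lemma proper_colouring_of_sparse: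
  assumes G: "simple_graph G"
    and sparse: "\<And>U. U \<subseteq> verts G \<Longrightarrow> U \<noteq> {} \<Longrightarrow> 2 * card {e \<in> edges G. e \<subseteq> U} < k * card U"
    and "W \<subseteq> verts G"
  shows "\<exists>f :: 'a \<Rightarrow> nat. (\<forall>v\<in>W. f v < k) \<and> (\<forall>x\<in>W. \<forall>y\<in>W. {x, y} \<in> edges G \<longrightarrow> f x \<noteq> f y)"
  using assms(3)
proof (induction "card W" arbitrary: W)
  case 0
  then have "W = {}"
    using simple_graph_finite(1)[OF G] finite_subset by fastforce
  then show ?case by simp
next
  case (Suc n)
  let ?F = "{e \<in> edges G. e \<subseteq> W}"
  have finW: "finite W"
    using Suc.prems simple_graph_finite(1)[OF G] finite_subset by blast
  have finF: "finite ?F"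
    using simple_graph_finite(2)[OF G] by simp
  have "card {v \<in> W. v \<in> e} = 2" if "e \<in> ?F" for e
  proof -
    have "{v \<in> W. v \<in> e} = e" "card e = 2"
      using that G by (auto simp: simple_graph_def nsets_def)
    then show ?thesis by simp
  qed
  then have "(\<Sum>v\<in>W. card {e \<in> ?F. v \<in> e}) = 2 * card ?F"
    using finW finF by (intro sum_multicount) auto
  moreover have "W \<noteq> {}"
    using Suc.hyps(2) by auto
  ultimately have "(\<Sum>v\<in>W. card {e \<in> ?F. v \<in> e}) < (\<Sum>v\<in>W. k)"
    using sparse[OF Suc.prems] by (simp add: mult.commute)
  then obtain v where v: "v \<in> W" "card {e \<in> ?F. v \<in> e} < k"
    by (meson not_less sum_mono)
  have "card (W - {v}) = n"
    using Suc.hyps(2) v(1) finW by simp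
  then obtain f where f: "\<forall>u\<in>W - {v}. f u < k"
    "\<forall>x\<in>W - {v}. \<forall>y\<in>W - {v}. {x, y} \<in> edges G \<longrightarrow> f x \<noteq> f y"
    using Suc.hyps(1)[of "W - {v}"] Suc.prems by blast
  let ?N = "{u \<in> W. {u, v} \<in> edges G}"
  have "card ?N \<le> card {e \<in> ?F. v \<in> e}"
    using v(1) simple_graph_finite(2)[OF G] by (intro card_inj_on_le[of "\<lambda>u. {u, v}"]) (auto simp: inj_on_def doubleton_eq_iff)
  then have "card (f ` ?N) < card {..<k}"
    using card_image_le[of ?N f] finW v(2) by simp
  then have "\<not> {..<k} \<subseteq> f ` ?N"
    using finW card_mono[of "f ` ?N" "{..<k}"] by auto
  then obtain c where c: "c < k" "c \<notin> f ` ?N"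
    by blast
  let ?f = "f(v := c)"
  have "?f x \<noteq> ?f y" if "x \<in> W" "y \<in> W" "{x, y} \<in> edges G" for x y
  proof -
    have "x \<noteq> y"
      using that(3) G by (auto simp: simple_graph_def nsets_def)
    moreover have fresh: "f u \<noteq> c" if "u \<in> W" "{u, v} \<in> edges G" for u
      using that c(2) by auto
    moreover have "{y, x} \<in> edges G"
      using that(3) by (simp add: insert_commute)
    ultimately show ?thesis
      using that f(2) fresh[of x] fresh[of y] by (cases "x = v"; cases "y = v") auto
  qed
  then show ?case
    using f(1) c(1) by (intro exI[of _ ?f]) auto
qed

lemma odd_cycle_not_alternating:
  fixes b :: "nat \<Rightarrow> bool"
  assumes "odd l" "\<And>k. k < l \<Longrightarrow> b k \<noteq> b (Suc k mod l)"
  shows False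
proof -
  have "b k \<longleftrightarrow> (b 0 \<longleftrightarrow> even k)" if "k < l" for k
    using that
  proof (induction k)
    case (Suc k)
    then show ?case
      using assms(2)[of k] by auto
  qed simp
  moreover have "l > 0"
    using assms(1) by (cases l) auto
  moreover from this have "Suc (l - 1) mod l = 0" "even (l - 1)"
    using assms(1) by simp_all
  ultimately show False
    using assms(2)[of "l - 1"] by (metis diff_less zero_less_one)
qed

lemma bit_less_of_less_power: "bit (n :: nat) j \<Longrightarrow> n < 2 ^ r \<Longrightarrow> j < r"
proof (rule ccontr)
  assume n: "bit n j" "n < 2 ^ r" and "\<not> j < r"
  then have "(2 :: nat) ^ r \<le> 2 ^ j"
    by (intro power_increasing) auto
  then have "n < 2 ^ j"
    using n(2) by linarith
  then show False
    using n(1) by (simp add: bit_iff_odd)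
qed

lemma odd_cycle_lower_bound:
  assumes "odd l" "l \<ge> 3" "r \<ge> 1"
  shows "2 ^ (r - 1) \<le> Ramsey_density (cycle_graph l) r"
proof (rule Ramsey_density_ge)
  fix G :: "nat graph"
  assume G: "simple_graph G" and less: "max_density G < 2 ^ (r - 1)"
  have "2 * card {e \<in> edges G. e \<subseteq> U} < 2 ^ r * card U" if U: "U \<subseteq> verts G" "U \<noteq> {}" for U
  proof -
    have "card U > 0"
      using U simple_graph_finite(1)[OF G] finite_subset by (auto simp: card_gt_0_iff)
    then have "real (card {e \<in> edges G. e \<subseteq> U}) < 2 ^ (r - 1) * real (card U)"
      using card_induced_le_max_density[OF G U] less
      by (smt (verit) mult_less_cancel_right_pos of_nat_0_less_iff)
    also have "\<dots> = real (2 ^ (r - 1) * card U)"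
      by simp
    finally have "card {e \<in> edges G. e \<subseteq> U} < 2 ^ (r - 1) * card U"
      by linarith
    moreover have "(2 :: nat) ^ r = 2 * 2 ^ (r - 1)"
      using assms(3) by (cases r) auto
    ultimately show ?thesis by simp
  qed
  then obtain f :: "nat \<Rightarrow> nat" where f: "\<And>v. v \<in> verts G \<Longrightarrow> f v < 2 ^ r"
    "\<And>x y. x \<in> verts G \<Longrightarrow> y \<in> verts G \<Longrightarrow> {x, y} \<in> edges G \<Longrightarrow> f x \<noteq> f y"
    using proper_colouring_of_sparse[OF G _ order_refl, of "2 ^ r"] by blast
  define c where "c e = (LEAST j. \<exists>x y. e = {x, y} \<and> bit (f x) j \<noteq> bit (f y) j)" for e
  have c: "c {x, y} < r \<and> bit (f x) (c {x, y}) \<noteq> bit (f y) (c {x, y})" if "{x, y} \<in> edges G" for x y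
  proof -
    have xy: "x \<in> verts G" "y \<in> verts G"
      using G that by (auto simp: simple_graph_def nsets_def)
    then have "\<exists>j. bit (f x) j \<noteq> bit (f y) j"
      using f(2)[OF _ _ that] by (metis bit_eqI)
    then have "\<exists>j u v. {x, y} = {u, v} \<and> bit (f u) j \<noteq> bit (f v) j"
      by blast
    then have "\<exists>u v. {x, y} = {u, v} \<and> bit (f u) (c {x, y}) \<noteq> bit (f v) (c {x, y})"
      unfolding c_def by (rule LeastI_ex)
    then have "bit (f x) (c {x, y}) \<noteq> bit (f y) (c {x, y})"
      by (auto simp: doubleton_eq_iff)
    then show ?thesis
      using bit_less_of_less_power f(1) xy by blast
  qed
  show "\<not> is_Ramsey (cycle_graph l) r G"
  proof (rule not_RamseyI[where c = c])
    show "c e < r" if "e \<in> edges G" for e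
      using simple_graph_edgeE[OF G that] c that by metis
  next
    fix i \<phi>
    assume "\<forall>k<l. {\<phi> k, \<phi> (Suc k mod l)} \<in> edges G \<and> c {\<phi> k, \<phi> (Suc k mod l)} = i"
    then have "bit (f (\<phi> k)) i \<noteq> bit (f (\<phi> (Suc k mod l))) i" if "k < l" for k
      using c that by metis
    then show False
      by (rule odd_cycle_not_alternating[OF assms(1), of "\<lambda>k. bit (f (\<phi> k)) i"])
  qed
qed (use assms simple_cycle_graph in \<open>auto simp: cycle_graph_def lessThan_empty_iff\<close>)

section \<open>Monochromatic cycles above rich vertex sets\<close>

lemma infinite_memberE:
  assumes "infinite A" "finite B"
  obtains x where "x \<in> A" "x \<notin> B"
proof -
  have "A - B \<noteq> {}"
    using Diff_infinite_finite[OF assms(2,1)] by (metis finite.emptyI)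
  then show thesis
    using that by blast
qed

definition cyclic :: "('a \<Rightarrow> 'a \<Rightarrow> bool) \<Rightarrow> 'a list \<Rightarrow> bool" where
  "cyclic R zs \<longleftrightarrow> zs \<noteq> [] \<and> distinct zs \<and> successively R zs \<and> R (last zs) (hd zs)"

text \<open>
  A cherry is a path with two edges; \<open>k + 1\<close> cherries are chained here. The set
  \<open>F\<close> contains the vertices that must be avoided; since all choices are infinite, the
  path can be built greedily.
\<close>

lemma cherry_path:
  assumes "infinite A" and cherries: "\<And>x y. x \<in> A \<Longrightarrow> y \<in> A \<Longrightarrow> x \<noteq> y \<Longrightarrow> infinite {w. R x w \<and> R w y}"
    and "finite F" "x \<in> A" "y \<in> A" "x \<noteq> y"
  shows "\<exists>ps. length ps = Suc (2 * k) \<and> distinct ps \<and> set ps \<inter> (F \<union> {x, y}) = {} \<and>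
           successively R (x # ps @ [y])"
  using assms(3-)
proof (induction k arbitrary: x F)
  case 0
  then have "infinite {w. R x w \<and> R w y}" "finite (F \<union> {x, y})"
    using cherries by auto
  then obtain w where w: "w \<in> {w. R x w \<and> R w y}" "w \<notin> F \<union> {x, y}"
    by (rule infinite_memberE)
  then show ?case
    by (intro exI[of _ "[w]"]) auto
next
  case (Suc k)
  have "finite (F \<union> {x, y})"
    using Suc.prems(1) by simp
  with assms(1) obtain z where z: "z \<in> A" "z \<notin> F \<union> {x, y}"
    by (rule infinite_memberE)
  have "infinite {w. R x w \<and> R w z}" "finite (F \<union> {x, y, z})"
    using cherries[of x z] Suc.prems z by auto
  then obtain w where w: "w \<in> {w. R x w \<and> R w z}" "w \<notin> F \<union> {x, y, z}"
    by (rule infinite_memberE)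
  obtain ps where ps: "length ps = Suc (2 * k)" "distinct ps"
    "set ps \<inter> (insert w (insert x F) \<union> {z, y}) = {}" "successively R (z # ps @ [y])"
    using Suc.IH[of "insert w (insert x F)" z] Suc.prems z by auto
  show ?case
    using ps w z by (intro exI[of _ "w # z # ps"]) auto
qed

lemma even_cycle_of_cherries:
  assumes "infinite A" and cherries: "\<And>x y. x \<in> A \<Longrightarrow> y \<in> A \<Longrightarrow> x \<noteq> y \<Longrightarrow> infinite {w. R x w \<and> R w y}"
    and "symp R" "even l" "l \<ge> 4"
  shows "\<exists>zs. cyclic R zs \<and> length zs = l"
proof -
  obtain x y where xy: "x \<in> A" "y \<in> A" "x \<noteq> y"
    using infinite_arbitrarily_large[OF assms(1), of 2] by (auto simp: card_2_iff)
  obtain m where "l = 2 * m"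
    using assms(4) by (rule evenE)
  then obtain k where k: "l = 2 * k + 4"
    using assms(5) that[of "m - 2"] by simp
  obtain ps where ps: "length ps = Suc (2 * k)" "distinct ps" "set ps \<inter> {x, y} = {}"
    "successively R (x # ps @ [y])"
    using cherry_path[OF assms(1,2), of "{}" x y k] xy by auto
  have "infinite {w. R y w \<and> R w x}" "finite (set ps \<union> {x, y})"
    using cherries[of y x] xy by auto
  then obtain w where w: "w \<in> {w. R y w \<and> R w x}" "w \<notin> set ps \<union> {x, y}"
    by (rule infinite_memberE)
  show ?thesis
    using ps w xy k by (intro exI[of _ "w # x # ps @ [y]"]) (auto simp: cyclic_def)
qed

lemma odd_cycle_of_cherries:
  assumes "infinite A" and cherries: "\<And>x y. x \<in> A \<Longrightarrow> y \<in> A \<Longrightarrow> x \<noteq> y \<Longrightarrow> infinite {w. R x w \<and> R w y}"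
    and xy: "x \<in> A" "y \<in> A" "x \<noteq> y"
    and path: "R x u" "R u v" "R v y" and distinct: "u \<noteq> v" "{u, v} \<inter> {x, y} = {}"
    and "odd l" "l \<ge> 5"
  shows "\<exists>zs. cyclic R zs \<and> length zs = l"
proof -
  obtain m where "l = 2 * m + 1"
    using assms(11) by (rule oddE)
  then obtain k where k: "l = 2 * k + 5"
    using assms(12) that[of "m - 2"] by simp
  obtain ps where ps: "length ps = Suc (2 * k)" "distinct ps" "set ps \<inter> ({u, v} \<union> {y, x}) = {}"
    "successively R (y # ps @ [x])"
    using cherry_path[OF assms(1,2), of "{u, v}" y x k] xy by auto
  have "successively R (y # ps @ [x] @ [u])"
    using ps(4) path(1) by (simp add: successively_append_iff flip: append_Cons append_assoc)
  then show ?thesis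
    using ps path xy distinct k
    by (intro exI[of _ "v # y # ps @ [x] @ [u]"]) (auto simp: cyclic_def)
qed

text \<open>
  \<open>N w\<close> is meant to be the set of neighbours of \<open>w\<close> that precede
  \<open>w\<close>. A \<open>0\<close>-rich set is just an infinite set.
\<close>

definition rich :: "('v \<Rightarrow> 'v set) \<Rightarrow> nat \<Rightarrow> 'v set \<Rightarrow> bool" where
  "rich N d W \<longleftrightarrow> (\<forall>X\<subseteq>W. finite X \<and> card X \<le> d \<longrightarrow> infinite {w \<in> W. X \<subseteq> N w})"

lemma richD: "rich N d W \<Longrightarrow> X \<subseteq> W \<Longrightarrow> finite X \<Longrightarrow> card X \<le> d \<Longrightarrow> infinite {w \<in> W. X \<subseteq> N w}"
  unfolding rich_def by blast

lemma rich_infinite: "rich N d W \<Longrightarrow> infinite W"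
  using richD[of N d W "{}"] by simp

text \<open>
  The members of \<open>X\<close> are used up by being added to each set that is tested for
  richness.
\<close>

lemma rich_above:
  assumes "rich N (card X + d) W" "X \<subseteq> W" "finite X"
  shows "rich N d {w \<in> W. X \<subseteq> N w}"
  unfolding rich_def
proof (intro allI impI)
  fix Y assume Y: "Y \<subseteq> {w \<in> W. X \<subseteq> N w}" "finite Y \<and> card Y \<le> d"
  have "card (X \<union> Y) \<le> card X + d"
    using card_Un_le[of X Y] Y(2) by linarith
  then have "infinite {w \<in> W. X \<union> Y \<subseteq> N w}"
    using assms(2,3) Y by (intro richD[OF assms(1)]) auto
  moreover have "{w \<in> {w \<in> W. X \<subseteq> N w}. Y \<subseteq> N w} = {w \<in> W. X \<union> Y \<subseteq> N w}"
    by blast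
  ultimately show "infinite {w \<in> {w \<in> W. X \<subseteq> N w}. Y \<subseteq> N w}"
    by simp
qed

text \<open>
  If each part had a set \<open>X t\<close> of at most \<open>d\<close> vertices with only
  finitely many common neighbours in that part, then the union of these sets would have only
  finitely many common neighbours in \<open>W\<close>.
\<close>

lemma rich_pigeonhole:
  assumes "rich N (card T * d) W" "finite T" "f ` W \<subseteq> T"
  obtains t where "t \<in> T" "rich N d {w \<in> W. f w = t}"
proof (rule ccontr)
  assume "\<not> thesis"
  then have "\<forall>t\<in>T. \<exists>X. X \<subseteq> {w \<in> W. f w = t} \<and> finite X \<and> card X \<le> d \<and>
      finite {w \<in> {w \<in> W. f w = t}. X \<subseteq> N w}"
    using that by (fastforce simp: rich_def)
  from bchoice[OF this] obtain X where X: "\<And>t. t \<in> T \<Longrightarrow> X t \<subseteq> {w \<in> W. f w = t}"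
    "\<And>t. t \<in> T \<Longrightarrow> finite (X t)" "\<And>t. t \<in> T \<Longrightarrow> card (X t) \<le> d"
    "\<And>t. t \<in> T \<Longrightarrow> finite {w \<in> {w \<in> W. f w = t}. X t \<subseteq> N w}"
    by blast
  have "card (\<Union>t\<in>T. X t) \<le> (\<Sum>t\<in>T. card (X t))"
    by (rule card_UN_le[OF assms(2)])
  also have "\<dots> \<le> card T * d"
    using sum_bounded_above[of T "\<lambda>t. card (X t)" d] X(3) by simp
  finally have "infinite {w \<in> W. (\<Union>t\<in>T. X t) \<subseteq> N w}"
    using X(1,2) assms(2) by (intro richD[OF assms(1)]) blast+
  moreover have "{w \<in> W. (\<Union>t\<in>T. X t) \<subseteq> N w} \<subseteq> (\<Union>t\<in>T. {w \<in> {w \<in> W. f w = t}. X t \<subseteq> N w})"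
    using assms(3) by auto
  moreover have "finite (\<Union>t\<in>T. {w \<in> {w \<in> W. f w = t}. X t \<subseteq> N w})"
    using assms(2) X(4) by blast
  ultimately show False
    using finite_subset by blast
qed

definition richly_joined ::
    "('v \<Rightarrow> 'v set) \<Rightarrow> ('v set \<Rightarrow> nat) \<Rightarrow> nat \<Rightarrow> 'v set \<Rightarrow> nat \<Rightarrow> 'v set \<Rightarrow> bool" where
  "richly_joined N c d W j e \<longleftrightarrow>
     (\<exists>U\<subseteq>W. rich N d U \<and> (\<forall>u\<in>U. e \<subseteq> N u \<and> (\<forall>x\<in>e. c {x, u} = j)))"

text \<open>
  Of \<open>|K| + 1\<close> vertices in \<open>W\<close>, each common neighbour sees two in the
  same colour. There are \<open>(|K| + 1)\<^sup>2 |K|\<close> possibilities for the two vertices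
  and the colour, so by \<open>rich_pigeonhole\<close> one of them occurs throughout a
  \<open>d\<close>-rich set. Thus, in the colouring of the pairs of \<open>W\<close> by a colour
  in which they are richly joined, or by a spare colour if there is none, an infinite homogeneous
  set cannot have the spare colour.
\<close>

lemma rich_common_neighbours:
  fixes c :: "'v set \<Rightarrow> nat"
  assumes rich: "rich N (Suc (card K) + (Suc (card K))\<^sup>2 * card K * d) W"
    and "finite K" and col: "\<And>x w. w \<in> W \<Longrightarrow> x \<in> W \<Longrightarrow> x \<in> N w \<Longrightarrow> c {x, w} \<in> K"
  shows "\<exists>A j. A \<subseteq> W \<and> infinite A \<and> j \<in> K \<and>
    (\<forall>x\<in>A. \<forall>y\<in>A. x \<noteq> y \<longrightarrow> richly_joined N c d W j {x, y})"
proof -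
  let ?joined = "richly_joined N c d W"
  have pair: "\<exists>x\<in>X. \<exists>y\<in>X. x \<noteq> y \<and> (\<exists>j\<in>K. ?joined j {x, y})"
    if X: "X \<subseteq> W" "finite X" "card X = Suc (card K)" for X
  proof -
    let ?W = "{w \<in> W. X \<subseteq> N w}"
    have rich': "rich N ((Suc (card K))\<^sup>2 * card K * d) ?W"
      using rich_above[of N X] rich X by simp
    have "\<forall>w\<in>?W. \<exists>p. p \<in> X \<times> X \<times> K \<and>
        (case p of (x, y, j) \<Rightarrow> x \<noteq> y \<and> c {x, w} = j \<and> c {y, w} = j)"
    proof
      fix w assume w: "w \<in> ?W"
      have sub: "(\<lambda>x. c {x, w}) ` X \<subseteq> K"
        using w X(1) col by blast
      then have "card ((\<lambda>x. c {x, w}) ` X) < card X"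
        using card_mono[OF assms(2) sub] X(3) by linarith
      then have "\<not> inj_on (\<lambda>x. c {x, w}) X"
        by (rule pigeonhole)
      then obtain x y where "x \<in> X" "y \<in> X" "x \<noteq> y" "c {x, w} = c {y, w}"
        by (auto simp: inj_on_def)
      then show "\<exists>p. p \<in> X \<times> X \<times> K \<and>
          (case p of (x, y, j) \<Rightarrow> x \<noteq> y \<and> c {x, w} = j \<and> c {y, w} = j)"
        using sub by (intro exI[of _ "(x, y, c {x, w})"]) auto
    qed
    from bchoice[OF this] obtain f where f: "\<forall>w\<in>?W. f w \<in> X \<times> X \<times> K \<and>
        (case f w of (x, y, j) \<Rightarrow> x \<noteq> y \<and> c {x, w} = j \<and> c {y, w} = j)" ..
    have card_triples: "card (X \<times> X \<times> K) = (Suc (card K))\<^sup>2 * card K"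
      using X(3) by (simp only: card_cartesian_product power2_eq_square mult.assoc)
    have "rich N (card (X \<times> X \<times> K) * d) ?W"
      unfolding card_triples by (rule rich')
    moreover have "finite (X \<times> X \<times> K)"
      using X(2) assms(2) by simp
    moreover have "f ` ?W \<subseteq> X \<times> X \<times> K"
      using f by blast
    ultimately obtain t where t: "t \<in> X \<times> X \<times> K" "rich N d {w \<in> ?W. f w = t}"
      by (rule rich_pigeonhole)
    obtain x y j where xyj: "t = (x, y, j)"
      by (cases t)
    let ?U = "{w \<in> ?W. f w = t}"
    have U: "x \<noteq> y \<and> c {x, u} = j \<and> c {y, u} = j" "{x, y} \<subseteq> N u" if "u \<in> ?U" for u
      using that bspec[OF f, of u] xyj by auto
    obtain u where "u \<in> ?U"
      using rich_infinite[OF t(2)] by (rule infinite_memberE[of _ "{}"]) auto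
    then have "x \<noteq> y"
      using U by blast
    moreover have "?joined j {x, y}"
      unfolding richly_joined_def using t(2) U by (intro exI[of _ ?U]) auto
    ultimately show ?thesis
      using t(1) xyj by blast
  qed
  (* The spare colour for pairs that are not richly joined. *)
  obtain r where r: "\<forall>j\<in>K. j < r"
    using assms(2) finite_nat_set_iff_bounded by blast
  define g where "g e = (if \<exists>j\<in>K. ?joined j e then SOME j. j \<in> K \<and> ?joined j e else r)" for e
  have g_joined: "g e \<in> K \<and> ?joined (g e) e" if "\<exists>j\<in>K. ?joined j e" for e
  proof -
    have "\<exists>j. j \<in> K \<and> ?joined j e"
      using that by blast
    then show ?thesis
      unfolding g_def if_P[OF that] by (rule someI_ex)
  qed
  have g: "g e \<in> K \<and> ?joined (g e) e \<or> g e = r" for e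
    using g_joined[of e] by (cases "\<exists>j\<in>K. ?joined j e") (simp_all add: g_def)
  then have "\<forall>x\<in>W. \<forall>y\<in>W. x \<noteq> y \<longrightarrow> g {x, y} < Suc r"
    using r less_SucI by (metis lessI)
  then obtain A j where A: "A \<subseteq> W" "infinite A" "\<forall>x\<in>A. \<forall>y\<in>A. x \<noteq> y \<longrightarrow> g {x, y} = j"
    using Ramsey2[OF rich_infinite[OF rich], of g "Suc r"] by blast
  obtain X where X: "X \<subseteq> A" "finite X" "card X = Suc (card K)"
    using infinite_arbitrarily_large[OF A(2)] by blast
  then obtain x y where xy: "x \<in> X" "y \<in> X" "x \<noteq> y" "\<exists>j\<in>K. ?joined j {x, y}"
    using pair[of X] A(1) by blast
  then have "g {x, y} \<in> K"
    using g_joined by blast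
  moreover have "g {x, y} = j"
    using A(3) X(1) xy by blast
  ultimately have j: "j \<in> K"
    by simp
  have "?joined j {x, y}" if "x \<in> A" "y \<in> A" "x \<noteq> y" for x y
  proof -
    have "g {x, y} = j"
      using A(3) that by blast
    then show ?thesis
      using g[of "{x, y}"] j r by (metis less_irrefl)
  qed
  then show ?thesis
    using A(1,2) j by blast
qed

definition link :: "('v \<Rightarrow> 'v set) \<Rightarrow> ('v set \<Rightarrow> nat) \<Rightarrow> nat \<Rightarrow> 'v \<Rightarrow> 'v \<Rightarrow> bool" where
  "link N c j x y \<longleftrightarrow> (x \<in> N y \<or> y \<in> N x) \<and> c {x, y} = j"

lemma symp_link: "symp (link N c j)"
  by (auto simp: symp_def link_def insert_commute)

lemma infinite_common_links:
  assumes "richly_joined N c d W j {x, y}"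
  shows "infinite {w. link N c j x w \<and> link N c j w y}"
proof -
  obtain U where U: "rich N d U" "\<forall>u\<in>U. {x, y} \<subseteq> N u \<and> (\<forall>z\<in>{x, y}. c {z, u} = j)"
    using assms unfolding richly_joined_def by blast
  then have "U \<subseteq> {w. link N c j x w \<and> link N c j w y}"
    by (auto simp: link_def insert_commute)
  then show ?thesis
    using rich_infinite[OF U(1)] finite_subset by blast
qed

lemma monochromatic_even_cycle:
  assumes "rich N (Suc r) W" and "\<And>x w. w \<in> W \<Longrightarrow> x \<in> N w \<Longrightarrow> c {x, w} < r"
    and "even l" "l \<ge> 4"
  shows "\<exists>j<r. \<exists>zs. cyclic (link N c j) zs \<and> length zs = l"
proof -
  have rich0: "rich N (Suc (card {..<r}) + (Suc (card {..<r}))\<^sup>2 * card {..<r} * 0) W"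
    using assms(1) by simp
  have col: "c {x, w} \<in> {..<r}" if "w \<in> W" "x \<in> W" "x \<in> N w" for x w
    using assms(2) that by simp
  obtain A j where "A \<subseteq> W" and A: "infinite A" "j \<in> {..<r}"
    "\<forall>x\<in>A. \<forall>y\<in>A. x \<noteq> y \<longrightarrow> richly_joined N c 0 W j {x, y}"
    using rich_common_neighbours[of N "{..<r}" 0 W c, OF rich0 finite_lessThan col] by blast
  have "infinite {w. link N c j x w \<and> link N c j w y}" if "x \<in> A" "y \<in> A" "x \<noteq> y" for x y
    using A(3) that infinite_common_links by metis
  then have "\<exists>zs. cyclic (link N c j) zs \<and> length zs = l"
    using even_cycle_of_cherries[OF A(1) _ symp_link assms(3,4)] by blast
  then show ?thesis
    using A(2) by auto
qed

primrec odd_richness :: "nat \<Rightarrow> nat" where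
  "odd_richness 0 = 1"
| "odd_richness (Suc k) = Suc (Suc k) + (Suc (Suc k))\<^sup>2 * Suc k * odd_richness k"

text \<open>
  Two vertices \<open>x\<close> and \<open>y\<close> of the infinite set are joined in colour
  \<open>j\<close> to a rich set \<open>U\<close>. An edge \<open>u v\<close> of colour
  \<open>j\<close> inside \<open>U\<close> gives the path \<open>x u v y\<close>, whose odd length
  is what the even paths between members of the infinite set lack. Without such an edge,
  \<open>U\<close> is a rich set in which only the colours \<open>K - {j}\<close> occur.
\<close>

lemma monochromatic_odd_cycle:
  assumes irrefl: "\<And>v. v \<notin> N v" and "finite K" and "rich N (odd_richness (card K)) W"
    and "\<And>x w. w \<in> W \<Longrightarrow> x \<in> W \<Longrightarrow> x \<in> N w \<Longrightarrow> c {x, w} \<in> K"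
    and "odd l" "l \<ge> 5"
  shows "\<exists>j\<in>K. \<exists>zs. cyclic (link N c j) zs \<and> length zs = l"
  using assms(2-4)
proof (induction "card K" arbitrary: K W)
  case 0
  then have "K = {}" and rich1: "rich N 1 W"
    by auto
  obtain x where x: "x \<in> W"
    using rich_infinite[OF rich1] by (rule infinite_memberE[of _ "{}"]) auto
  then have "infinite {w \<in> W. {x} \<subseteq> N w}"
    using richD[OF rich1, of "{x}"] by simp
  then obtain w where "w \<in> {w \<in> W. {x} \<subseteq> N w}"
    by (rule infinite_memberE[of _ "{}"]) auto
  then show ?case
    using 0(4)[of w x] x \<open>K = {}\<close> by simp
next
  case (Suc k)
  have "rich N (Suc (card K) + (Suc (card K))\<^sup>2 * card K * odd_richness k) W"
    using Suc.prems(2) Suc.hyps(2)[symmetric] by simp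
  then obtain A j where A: "A \<subseteq> W" "infinite A" "j \<in> K"
    "\<forall>x\<in>A. \<forall>y\<in>A. x \<noteq> y \<longrightarrow> richly_joined N c (odd_richness k) W j {x, y}"
    using rich_common_neighbours[of N K "odd_richness k" W c] Suc.prems(1,3) by blast
  have cherries: "infinite {w. link N c j x w \<and> link N c j w y}" if "x \<in> A" "y \<in> A" "x \<noteq> y" for x y
    using A(4) that infinite_common_links by metis
  obtain x y where xy: "x \<in> A" "y \<in> A" "x \<noteq> y"
    using infinite_arbitrarily_large[OF A(2), of 2] by (auto simp: card_2_iff)
  have "richly_joined N c (odd_richness k) W j {x, y}"
    using A(4) xy by blast
  then obtain U where U: "U \<subseteq> W" "rich N (odd_richness k) U"
    "\<forall>u\<in>U. {x, y} \<subseteq> N u \<and> (\<forall>z\<in>{x, y}. c {z, u} = j)"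
    unfolding richly_joined_def by blast
  show ?case
  proof (cases "\<exists>u\<in>U. \<exists>v\<in>U. u \<in> N v \<and> c {u, v} = j")
    case True
    then obtain u v where uv: "u \<in> U" "v \<in> U" "u \<in> N v" "c {u, v} = j"
      by blast
    have "link N c j x u" "link N c j u v" "link N c j v y"
      using uv U(3) by (auto simp: link_def insert_commute)
    moreover have "u \<noteq> v" "{u, v} \<inter> {x, y} = {}"
      using uv U(3) irrefl by auto
    ultimately have "\<exists>zs. cyclic (link N c j) zs \<and> length zs = l"
      using odd_cycle_of_cherries[OF A(2) cherries xy] assms(5,6) by blast
    then show ?thesis
      using A(3) by blast
  next
    case False
    have "card (K - {j}) = k"
      using Suc.hyps(2) Suc.prems(1) A(3) by simp
    moreover have "c {x, w} \<in> K - {j}" if "w \<in> U" "x \<in> U" "x \<in> N w" for x w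
      using False Suc.prems(3) U(1) that by blast
    ultimately have "\<exists>j'\<in>K - {j}. \<exists>zs. cyclic (link N c j') zs \<and> length zs = l"
      using Suc.prems(1) U(2) by (intro Suc.hyps(1)[of "K - {j}" U]) auto
    then show ?thesis by blast
  qed
qed

section \<open>A universal graph of bounded back-degree and its finite parts\<close>

text \<open>
  The compactness of a product of finite spaces, for sequences.
\<close>

lemma limit_along_prefixes:
  fixes f :: "nat \<Rightarrow> nat \<Rightarrow> nat"
  assumes "\<And>n k. f n k < r"
  shows "\<exists>g. \<forall>m. infinite {n. \<forall>k<m. f n k = g k}"
proof -
  have "\<exists>S :: nat \<Rightarrow> nat set. \<forall>m. infinite (S m) \<and> (S (Suc m) \<subseteq> S m \<and> (\<exists>v. \<forall>n\<in>S (Suc m). f n m = v))"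
  proof (rule dependent_nat_choice)
    show "\<exists>S :: nat set. infinite S"
      using infinite_UNIV_nat by blast
    fix S :: "nat set" and m
    assume S: "infinite S"
    have "(\<lambda>n. f n m) ` S \<subseteq> {..<r}"
      using assms by auto
    then have "finite ((\<lambda>n. f n m) ` S)"
      by (rule finite_subset) simp
    then obtain a where "infinite {n \<in> S. f n m = f a m}"
      using pigeonhole_infinite[OF S] by blast
    then show "\<exists>S'. infinite S' \<and> (S' \<subseteq> S \<and> (\<exists>v. \<forall>n\<in>S'. f n m = v))"
      by (intro exI[of _ "{n \<in> S. f n m = f a m}"]) auto
  qed
  then obtain S where S: "\<And>m. infinite (S m)" "\<And>m. S (Suc m) \<subseteq> S m"
    "\<And>m. \<exists>v. \<forall>n\<in>S (Suc m). f n m = v"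
    by blast
  obtain g where g: "\<And>m n. n \<in> S (Suc m) \<Longrightarrow> f n m = g m"
    using S(3) by metis
  have "S m \<subseteq> {n. \<forall>k<m. f n k = g k}" for m
  proof (intro subsetI CollectI allI impI)
    fix n k assume "n \<in> S m" "k < m"
    then have "n \<in> S (Suc k)"
      using lift_Suc_antimono_le[of S "Suc k" m] S(2) by auto
    then show "f n k = g k"
      by (rule g)
  qed
  then have "infinite {n. \<forall>k<m. f n k = g k}" for m
    using S(1) finite_subset by blast
  then show ?thesis by blast
qed

definition initial_graph :: "(nat \<Rightarrow> nat set) \<Rightarrow> nat \<Rightarrow> nat graph" where
  "initial_graph N n = \<lparr>verts = {..<n}, edges = {{a, b} |a b. b < n \<and> a \<in> N b}\<rparr>"

text \<open>
  Colourings of the finite initial parts without a monochromatic cycle have a limit colouring of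
  the whole graph. A monochromatic cycle of the limit has finitely many edges, so it is already
  present in one of the finite colourings.
\<close>

lemma compactness:
  assumes backward: "\<And>b. N b \<subseteq> {..<b}" and "r \<ge> 1"
    and mono: "\<And>c. (\<And>a b. a \<in> N b \<Longrightarrow> c {a, b} < r) \<Longrightarrow>
      \<exists>j<r. \<exists>zs. cyclic (link N c j) zs \<and> length zs = l"
  shows "\<exists>n. is_Ramsey (cycle_graph l) r (initial_graph N n)"
proof (rule ccontr)
  assume "\<not> ?thesis"
  then have "\<forall>n. \<exists>c. c \<in> edges (initial_graph N n) \<rightarrow> {..<r} \<and>
      (\<forall>i<r. \<not> contains_copy (colour_class (initial_graph N n) c i) (cycle_graph l))"
    unfolding is_Ramsey_def by blast
  from choice[OF this] obtain c where c: "\<And>n. c n \<in> edges (initial_graph N n) \<rightarrow> {..<r}"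
    "\<And>n i. i < r \<Longrightarrow> \<not> contains_copy (colour_class (initial_graph N n) (c n) i) (cycle_graph l)"
    by blast
  (* The colourings as sequences of natural numbers: position k holds the colour of the edge with code k,
     and 0 for codes of pairs that are not edges of the n-th graph. *)
  define f where "f n k = (case prod_decode k of (a, b) \<Rightarrow>
      if b < n \<and> a \<in> N b then c n {a, b} else 0)" for n k
  have edge: "{a, b} \<in> edges (initial_graph N n)" if "b < n" "a \<in> N b" for a b n
    using that by (auto simp: initial_graph_def)
  have f_less: "f n k < r" for n k
    using c(1)[of n] edge assms(2) by (auto simp: f_def split: prod.splits)
  obtain g where g: "\<And>m. infinite {n. \<forall>k<m. f n k = g k}"
    using limit_along_prefixes[of f r, OF f_less] by blast
  define d where "d e = g (prod_encode (Min e, Max e))" for e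
  have d_eq: "d {a, b} = g (prod_encode (a, b))" if "a \<in> N b" for a b
  proof -
    have "a < b"
      using that backward by auto
    then show ?thesis by (simp add: d_def)
  qed
  have "d {a, b} < r" if "a \<in> N b" for a b
  proof -
    obtain n where "n \<in> {n. \<forall>k<Suc (prod_encode (a, b)). f n k = g k}"
      using g by (rule infinite_memberE[of _ "{}"]) auto
    then have "g (prod_encode (a, b)) = f n (prod_encode (a, b))"
      by simp
    then show ?thesis
      using d_eq[OF that] f_less by simp
  qed
  then obtain j zs where j: "j < r" and zs: "cyclic (link N d j) zs" "length zs = l"
    using mono by blast
  have "finite (prod_encode ` (set zs \<times> set zs))" "finite (set zs)"
    by simp_all
  then obtain m p where m: "\<forall>k\<in>prod_encode ` (set zs \<times> set zs). k < m" and p: "\<forall>z\<in>set zs. z < p"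
    using finite_nat_set_iff_bounded by metis
  obtain n where "n \<in> {n. \<forall>k<m. f n k = g k}" "n \<notin> {..<p}"
    using g[of m] finite_lessThan by (rule infinite_memberE)
  then have n: "\<And>k. k < m \<Longrightarrow> f n k = g k" "p \<le> n"
    by auto
  let ?G = "colour_class (initial_graph N n) (c n) j"
  have agree: "{a, b} \<in> edges ?G" if "a \<in> set zs" "b \<in> set zs" "a \<in> N b" "d {a, b} = j" for a b
  proof -
    have "b < n"
      using p n(2) that(2) by (meson less_le_trans)
    moreover have "prod_encode (a, b) < m"
      using m that(1,2) by blast
    ultimately have "c n {a, b} = j"
      using n(1)[of "prod_encode (a, b)"] that d_eq[OF that(3)] by (simp add: f_def)
    then show ?thesis
      using edge[OF \<open>b < n\<close> that(3)] by (simp add: colour_class_def)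
  qed
  have link_edge: "{x, y} \<in> edges ?G" if "x \<in> set zs" "y \<in> set zs" "link N d j x y" for x y
    using that agree[of x y] agree[of y x] by (auto simp: link_def insert_commute)
  have "contains_copy ?G (cycle_graph l)"
  proof (rule contains_cycleI[where zs = zs])
    show "distinct zs" "length zs = l" "zs \<noteq> []"
      using zs by (simp_all add: cyclic_def)
    show "set zs \<subseteq> verts ?G"
      using p n(2) by (auto simp: colour_class_def initial_graph_def intro: less_le_trans)
    show "successively (\<lambda>x y. {x, y} \<in> edges ?G) zs"
      using zs(1) link_edge by (auto simp: cyclic_def intro: successively_mono)
    show "{last zs, hd zs} \<in> edges ?G"
      using zs(1) by (intro link_edge) (auto simp: cyclic_def)
  qed
  then show False
    using c(2)[OF j] by blast
qed

lemma simple_initial_graph: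
  assumes "\<And>b. N b \<subseteq> {..<b}"
  shows "simple_graph (initial_graph N n)"
proof -
  have "{a, b} \<in> [{..<n}]\<^bsup>2\<^esup>" if "b < n" "a \<in> N b" for a b
  proof -
    have "a < b" using assms that(2) by blast
    then show ?thesis using that(1) by simp
  qed
  then show ?thesis
    by (auto simp: simple_graph_def initial_graph_def)
qed

text \<open>
  Every edge is counted at its larger end, and the least vertex of \<open>W\<close> is not the
  larger end of an edge inside \<open>W\<close>, which makes the inequality strict.
\<close>

lemma max_density_initial_graph:
  assumes backward: "\<And>b. N b \<subseteq> {..<b}" and deg: "\<And>b. card (N b) \<le> D" and "D \<ge> 1" "n \<ge> 1"
  shows "max_density (initial_graph N n) < real D"
proof (rule max_density_less[OF simple_initial_graph[OF backward]])
  show "verts (initial_graph N n) \<noteq> {}"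
    using assms(4) by (auto simp: initial_graph_def lessThan_empty_iff)
  fix W assume W: "W \<subseteq> verts (initial_graph N n)" "W \<noteq> {}"
  have finW: "finite W"
    using W(1) finite_subset by (auto simp: initial_graph_def)
  have finN: "finite (N b)" for b
    using backward finite_subset by blast
  let ?E = "{e \<in> edges (initial_graph N n). e \<subseteq> W}"
  have "?E \<subseteq> (\<Union>b\<in>W - {Min W}. (\<lambda>a. {a, b}) ` N b)"
  proof
    fix e assume "e \<in> ?E"
    then obtain a b where e: "e = {a, b}" "a \<in> N b" "a \<in> W" "b \<in> W"
      by (auto simp: initial_graph_def)
    then have "b \<noteq> Min W"
      using backward Min_le[OF finW e(3)] by (metis lessThan_iff not_less subsetD)
    then show "e \<in> (\<Union>b\<in>W - {Min W}. (\<lambda>a. {a, b}) ` N b)"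
      using e by blast
  qed
  then have "card ?E \<le> card (\<Union>b\<in>W - {Min W}. (\<lambda>a. {a, b}) ` N b)"
    using finW finN by (intro card_mono) auto
  also have "\<dots> \<le> (\<Sum>b\<in>W - {Min W}. card ((\<lambda>a. {a, b}) ` N b))"
    using finW by (intro card_UN_le) auto
  also have "\<dots> \<le> (\<Sum>b\<in>W - {Min W}. D)"
    by (intro sum_mono order_trans[OF card_image_le[OF finN] deg])
  also have "\<dots> = D * (card W - 1)"
    using finW Min_in[OF finW W(2)] by simp
  also have "\<dots> < D * card W"
    using assms(3) finW W(2) by (simp add: card_gt_0_iff)
  finally show "real (card ?E) < real D * real (card W)"
    by (simp flip: of_nat_mult)
qed

text \<open>
  The vertex \<open>b\<close> encodes a pair consisting of a finite set and a number. The set is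
  its neighbourhood among the smaller vertices, provided that it is small enough and below
  \<open>b\<close>, while the number makes sure that every set occurs infinitely often.
\<close>

definition earlier :: "nat \<Rightarrow> nat \<Rightarrow> nat set" where
  "earlier D b = (let X = set_decode (fst (prod_decode b)) in
     if X \<subseteq> {..<b} \<and> card X \<le> D then X else {})"

lemma earlier_subset: "earlier D b \<subseteq> {..<b}"
  by (auto simp: earlier_def Let_def)

lemma card_earlier: "card (earlier D b) \<le> D"
  by (auto simp: earlier_def Let_def)

lemma rich_earlier: "rich (earlier D) D UNIV"
  unfolding rich_def
proof (intro allI impI)
  fix X :: "nat set"
  assume X: "finite X \<and> card X \<le> D"
  then obtain m where m: "X \<subseteq> {..<m}"
    using finite_nat_iff_bounded by blast
  let ?f = "\<lambda>s. prod_encode (set_encode X, s)"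
  have "inj ?f"
    by (auto simp: inj_def)
  then have "infinite (range ?f - {..<m})"
    by (intro Diff_infinite_finite) (auto dest: finite_imageD)
  moreover have "range ?f - {..<m} \<subseteq> {w \<in> UNIV. X \<subseteq> earlier D w}"
    using X m by (auto simp: earlier_def Let_def)
  ultimately show "infinite {w \<in> UNIV. X \<subseteq> earlier D w}"
    using finite_subset by blast
qed

lemma Ramsey_density_less:
  assumes "l \<ge> 3" "r \<ge> 1" "D \<ge> 1"
    and "\<And>c. (\<And>a b. a \<in> earlier D b \<Longrightarrow> c {a, b} < r) \<Longrightarrow>
      \<exists>j<r. \<exists>zs. cyclic (link (earlier D) c j) zs \<and> length zs = l"
  shows "Ramsey_density (cycle_graph l) r < real D"
proof -
  obtain n where n: "is_Ramsey (cycle_graph l) r (initial_graph (earlier D) n)"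
    using compactness[OF earlier_subset assms(2,4)] by blast
  have F: "simple_graph (cycle_graph l)" "verts (cycle_graph l) \<noteq> {}"
    using simple_cycle_graph[OF assms(1)] assms(1) by (auto simp: cycle_graph_def lessThan_empty_iff)
  have "(\<lambda>_. 0) \<in> edges (initial_graph (earlier D) n) \<rightarrow> {..<r}"
    using assms(2) by auto
  then obtain i where
    "contains_copy (colour_class (initial_graph (earlier D) n) (\<lambda>_. 0) i) (cycle_graph l)"
    using n unfolding is_Ramsey_def by blast
  then obtain \<phi> where "\<phi> ` {..<l} \<subseteq> {..<n}"
    by (auto simp: contains_cycle_iff colour_class_def initial_graph_def)
  then have "\<phi> 0 < n"
    using assms(1) by (simp add: image_subset_iff)
  then have "max_density (initial_graph (earlier D) n) < real D"
    using max_density_initial_graph[OF earlier_subset card_earlier assms(3)] by simp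
  moreover have "Ramsey_density (cycle_graph l) r \<le> max_density (initial_graph (earlier D) n)"
    by (rule Ramsey_density_le[OF F simple_initial_graph[OF earlier_subset] n])
  ultimately show ?thesis by linarith
qed

lemma even_cycle_upper_bound:
  assumes "even l" "l \<ge> 4" "r \<ge> 1"
  shows "Ramsey_density (cycle_graph l) r < real r + 1"
proof -
  have "Ramsey_density (cycle_graph l) r < real (Suc r)"
  proof (rule Ramsey_density_less)
    fix c :: "nat set \<Rightarrow> nat"
    assume "\<And>a b. a \<in> earlier (Suc r) b \<Longrightarrow> c {a, b} < r"
    then show "\<exists>j<r. \<exists>zs. cyclic (link (earlier (Suc r)) c j) zs \<and> length zs = l"
      using monochromatic_even_cycle[OF rich_earlier, of r c l] assms by blast
  qed (use assms in auto)
  then show ?thesis by simp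
qed

lemma odd_cycle_upper_bound:
  assumes "odd l" "l \<ge> 5" "r \<ge> 1"
  shows "Ramsey_density (cycle_graph l) r < real (odd_richness r)"
proof (rule Ramsey_density_less)
  show "odd_richness r \<ge> 1"
    by (cases r) auto
  fix c :: "nat set \<Rightarrow> nat"
  assume c: "\<And>a b. a \<in> earlier (odd_richness r) b \<Longrightarrow> c {a, b} < r"
  have "v \<notin> earlier (odd_richness r) v" for v
    using earlier_subset by blast
  moreover have "rich (earlier (odd_richness r)) (odd_richness (card {..<r})) UNIV"
    by (simp add: rich_earlier)
  ultimately have "\<exists>j\<in>{..<r}. \<exists>zs. cyclic (link (earlier (odd_richness r)) c j) zs \<and> length zs = l"
    using c assms(1,2) by (intro monochromatic_odd_cycle[where W = UNIV]) auto
  then show "\<exists>j<r. \<exists>zs. cyclic (link (earlier (odd_richness r)) c j) zs \<and> length zs = l"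
    by blast
qed (use assms in auto)

section \<open>The Ramsey density of cycles\<close>

theorem theorem2:
  shows "(\<forall>l r :: nat. even l \<and> l \<ge> 4 \<and> r \<ge> 2 \<longrightarrow>
            (let \<epsilon> = (real r - 1) / real (max (Ramsey_number (cycle_graph l) r) (2 * r + 1))
             in \<epsilon> < 1 / 2 \<and>
                real r - \<epsilon> \<le> Ramsey_density (cycle_graph l) r \<and>
                Ramsey_density (cycle_graph l) r < real r + 1))
       \<and> (\<exists>f :: nat \<Rightarrow> real. \<forall>l r :: nat. odd l \<and> l \<ge> 3 \<and> r \<ge> 2 \<longrightarrow>
            2 ^ (r - 1) \<le> Ramsey_density (cycle_graph l) r \<and>
            Ramsey_density (cycle_graph l) r \<le> f r)"
proof (rule conjI)
  have eps: "(real r - 1) / real M < 1 / 2" if "2 * r + 1 \<le> M" for r M :: nat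
  proof -
    have "real (2 * r + 1) \<le> real M"
      using that by (simp only: of_nat_le_iff)
    then have "2 * (real r - 1) < real M" "real M > 0"
      by simp_all
    then show ?thesis
      by (simp add: divide_less_eq)
  qed
  show "\<forall>l r :: nat. even l \<and> l \<ge> 4 \<and> r \<ge> 2 \<longrightarrow>
      (let \<epsilon> = (real r - 1) / real (max (Ramsey_number (cycle_graph l) r) (2 * r + 1))
       in \<epsilon> < 1 / 2 \<and>
          real r - \<epsilon> \<le> Ramsey_density (cycle_graph l) r \<and>
          Ramsey_density (cycle_graph l) r < real r + 1)"
    unfolding Let_def
  proof (intro allI impI conjI)
    fix l r :: nat
    assume lr: "even l \<and> l \<ge> 4 \<and> r \<ge> 2"
    show "(real r - 1) / real (max (Ramsey_number (cycle_graph l) r) (2 * r + 1)) < 1 / 2"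
      by (rule eps) simp
    show "real r - (real r - 1) / real (max (Ramsey_number (cycle_graph l) r) (2 * r + 1))
        \<le> Ramsey_density (cycle_graph l) r"
      using lr by (intro cycle_lower_bound) auto
    show "Ramsey_density (cycle_graph l) r < real r + 1"
      using lr by (intro even_cycle_upper_bound) auto
  qed
  show "\<exists>f :: nat \<Rightarrow> real. \<forall>l r :: nat. odd l \<and> l \<ge> 3 \<and> r \<ge> 2 \<longrightarrow>
      2 ^ (r - 1) \<le> Ramsey_density (cycle_graph l) r \<and> Ramsey_density (cycle_graph l) r \<le> f r"
  proof (intro exI allI impI conjI)
    fix l r :: nat
    assume lr: "odd l \<and> l \<ge> 3 \<and> r \<ge> 2"
    show "2 ^ (r - 1) \<le> Ramsey_density (cycle_graph l) r"
      using lr by (intro odd_cycle_lower_bound) auto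
    (* The triangle is too short for the construction, but it is a single graph,
       so its own Ramsey density can be part of the bound. *)
    show "Ramsey_density (cycle_graph l) r
        \<le> max (real (odd_richness r)) (Ramsey_density (cycle_graph 3) r)"
    proof (cases "l = 3")
      case False
      moreover have "l \<noteq> 4"
        using lr by auto
      ultimately have "Ramsey_density (cycle_graph l) r < real (odd_richness r)"
        using lr by (intro odd_cycle_upper_bound) auto
      then show ?thesis by linarith
    qed simp
  qed
qed

end
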